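(* There is a deterministic algorithm which, given an energy game with $n$ nodes, finds in $n^{O(1)}\cdot 2^{n/2}$ time and $n^{O(1)}$ space the set of all nodes that are winning for Max. The algorithm can be performed even when the edge weights are arbitrary real numbers (assuming basic arithmetic operations with them are carried out by an oracle).
   Context: An energy game is given by a finite directed graph $G=(V,E)$ in which every node has at least one outgoing edge, a partition $V=V_{\mathrm{Max}}\sqcup V_{\mathrm{Min}}$ and a weight function $w\colon E\to\mathbb{R}$. The weight of a cycle is the sum of weights of its edges. A positional strategy of Max is a map $\sigma\colon V_{\mathrm{Max}}\to E$ with $\sigma(a)$ an edge starting at $a$; $G^\sigma$ is the graph on $V$ whose edges are all edges starting in $V_{\mathrm{Min}}$ together with the edges $\sigma(a)$, $a\in V_{\mathrm{Max}}$. A node $v$ is winning for Max if there is a positional strategy $\sigma$ of Max such that every cycle reachable from $v$ in $G^\sigma$ has non-negative weight. *)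

theory Defs
  imports
    "Graph_Theory.Pair_Digraph"
    "HOL-Library.Log_Nat"
    "HOL-Library.Landau_Symbols"
begin

section \<open>Energy games\<close>

text \<open>
  An energy game is an arena together with an arbitrary weight function
  \<open>w :: 'v \<times> 'v \<Rightarrow> real\<close>, of which only the values on the edges matter.
\<close>

locale arena = pair_fin_digraph G
  for G :: "'v pair_pre_digraph" +
  fixes VMax VMin :: "'v set"
  assumes nodes_partition: "pverts G = VMax \<union> VMin" "VMax \<inter> VMin = {}"
    and out_edge: "\<And>a. a \<in> pverts G \<Longrightarrow> \<exists>e\<in>parcs G. fst e = a"

definition positional_strategy ::
  "'v pair_pre_digraph \<Rightarrow> 'v set \<Rightarrow> ('v \<Rightarrow> 'v \<times> 'v) \<Rightarrow> bool" where
  "positional_strategy G VMax \<sigma> \<longleftrightarrow> (\<forall>a\<in>VMax. \<sigma> a \<in> parcs G \<and> fst (\<sigma> a) = a)"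

definition strategy_graph ::
  "'v pair_pre_digraph \<Rightarrow> 'v set \<Rightarrow> 'v set \<Rightarrow> ('v \<Rightarrow> 'v \<times> 'v) \<Rightarrow> 'v pair_pre_digraph" where
  "strategy_graph G VMax VMin \<sigma> =
     \<lparr>pverts = pverts G, parcs = {e \<in> parcs G. fst e \<in> VMin} \<union> \<sigma> ` VMax\<rparr>"

definition winning_for_max ::
  "'v pair_pre_digraph \<Rightarrow> 'v set \<Rightarrow> 'v set \<Rightarrow> ('v \<times> 'v \<Rightarrow> real) \<Rightarrow> 'v \<Rightarrow> bool" where
  "winning_for_max G VMax VMin w v \<longleftrightarrow> v \<in> pverts G \<and>
     (\<exists>\<sigma>. positional_strategy G VMax \<sigma> \<and>
        (\<forall>p. pre_digraph.cycle (strategy_graph G VMax VMin \<sigma>) p \<and>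
             (\<exists>e\<in>set p. v \<rightarrow>\<^sup>*\<^bsub>strategy_graph G VMax VMin \<sigma>\<^esub> fst e)
           \<longrightarrow> 0 \<le> sum_list (map w p)))"


section \<open>Algorithms\<close>

text \<open>
  Algorithms are programs of a deterministic while language over two sorts of random access
  memory: one holding natural numbers, which also serve as addresses, and one holding real
  numbers. Both are organised in named arrays. Real numbers are only accessible through the
  operations of the oracle, namely the four arithmetic operations, integer constants and
  comparison; in particular there is no rounding of reals to integers, and no real
  constant other than the integers can be written in a program.
\<close>

type_synonym aname = string

datatype nexp =
    NConst nat
  | NGet aname nexp
  | NAdd nexp nexp
  | NSub nexp nexp
  | NMul nexp nexp
  | NDiv nexp nexp
  | NMod nexp nexp

datatype rexp =
    RConst int
  | RGet aname nexp
  | RAdd rexp rexp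
  | RSub rexp rexp
  | RMul rexp rexp
  | RDiv rexp rexp

datatype bexp =
    NLess nexp nexp
  | RLess rexp rexp
  | BNot bexp
  | BAnd bexp bexp

datatype com =
    Skip
  | NSet aname nexp nexp
  | RSet aname nexp rexp
  | Seq com com
  | Cond bexp com com
  | While bexp com

record state =
  nmem :: "aname \<Rightarrow> nat \<Rightarrow> nat"
  rmem :: "aname \<Rightarrow> nat \<Rightarrow> real"

primrec nval :: "nexp \<Rightarrow> state \<Rightarrow> nat" where
  "nval (NConst k) s = k"
| "nval (NGet x i) s = nmem s x (nval i s)"
| "nval (NAdd a b) s = nval a s + nval b s"
| "nval (NSub a b) s = nval a s - nval b s"
| "nval (NMul a b) s = nval a s * nval b s"
| "nval (NDiv a b) s = nval a s div nval b s"
| "nval (NMod a b) s = nval a s mod nval b s"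

primrec rval :: "rexp \<Rightarrow> state \<Rightarrow> real" where
  "rval (RConst k) s = of_int k"
| "rval (RGet x i) s = rmem s x (nval i s)"
| "rval (RAdd a b) s = rval a s + rval b s"
| "rval (RSub a b) s = rval a s - rval b s"
| "rval (RMul a b) s = rval a s * rval b s"
| "rval (RDiv a b) s = rval a s / rval b s"

primrec bval :: "bexp \<Rightarrow> state \<Rightarrow> bool" where
  "bval (NLess a b) s = (nval a s < nval b s)"
| "bval (RLess a b) s = (rval a s < rval b s)"
| "bval (BNot b) s = (\<not> bval b s)"
| "bval (BAnd b c) s = (bval b s \<and> bval c s)"

text \<open>The time to evaluate an expression is the number of its operations.\<close>

primrec ntime :: "nexp \<Rightarrow> nat" where
  "ntime (NConst k) = 1"
| "ntime (NGet x i) = 1 + ntime i"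
| "ntime (NAdd a b) = 1 + ntime a + ntime b"
| "ntime (NSub a b) = 1 + ntime a + ntime b"
| "ntime (NMul a b) = 1 + ntime a + ntime b"
| "ntime (NDiv a b) = 1 + ntime a + ntime b"
| "ntime (NMod a b) = 1 + ntime a + ntime b"

primrec rtime :: "rexp \<Rightarrow> nat" where
  "rtime (RConst k) = 1"
| "rtime (RGet x i) = 1 + ntime i"
| "rtime (RAdd a b) = 1 + rtime a + rtime b"
| "rtime (RSub a b) = 1 + rtime a + rtime b"
| "rtime (RMul a b) = 1 + rtime a + rtime b"
| "rtime (RDiv a b) = 1 + rtime a + rtime b"

primrec btime :: "bexp \<Rightarrow> nat" where
  "btime (NLess a b) = 1 + ntime a + ntime b"
| "btime (RLess a b) = 1 + rtime a + rtime b"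
| "btime (BNot b) = 1 + btime b"
| "btime (BAnd b c) = 1 + btime b + btime c"

definition nset :: "aname \<Rightarrow> nat \<Rightarrow> nat \<Rightarrow> state \<Rightarrow> state" where
  "nset x i k s = s\<lparr>nmem := (nmem s)(x := (nmem s x)(i := k))\<rparr>"

definition rset :: "aname \<Rightarrow> nat \<Rightarrow> real \<Rightarrow> state \<Rightarrow> state" where
  "rset x i r s = s\<lparr>rmem := (rmem s)(x := (rmem s x)(i := r))\<rparr>"

definition used_n :: "state \<Rightarrow> (aname \<times> nat) set" where
  "used_n s = {(x, i). nmem s x i \<noteq> 0}"

definition used_r :: "state \<Rightarrow> (aname \<times> nat) set" where
  "used_r s = {(x, i). rmem s x i \<noteq> 0}"

text \<open>
  A cell in use is charged the binary length of its address; a natural number is charged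
  its binary length, a real number one unit. Counting the bits of the natural numbers keeps
  the unit time of their operations honest: if a fixed program runs within space \<open>S\<close>, all
  natural numbers it operates on have \<open>O(S)\<close> bits. The sets of cells in use are always
  finite, see \<open>exec_finite_used\<close> and \<open>finite_used_input\<close> below.
\<close>

definition space :: "state \<Rightarrow> nat" where
  "space s = (\<Sum>(x, i)\<in>used_n s. 1 + floorlog 2 i + floorlog 2 (nmem s x i))
           + (\<Sum>(x, i)\<in>used_r s. 1 + floorlog 2 i)"

text \<open>
  \<open>exec c s t m s'\<close>: started in \<open>s\<close>, the program \<open>c\<close> halts in \<open>s'\<close> after time \<open>t\<close>, and \<open>m\<close> is
  the maximum space of the states on the way.
\<close>

inductive exec :: "com \<Rightarrow> state \<Rightarrow> nat \<Rightarrow> nat \<Rightarrow> state \<Rightarrow> bool" where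
  Skip: "exec Skip s 1 (space s) s"
| NSet: "s' = nset x (nval i s) (nval a s) s \<Longrightarrow>
    exec (NSet x i a) s (1 + ntime i + ntime a) (max (space s) (space s')) s'"
| RSet: "s' = rset x (nval i s) (rval a s) s \<Longrightarrow>
    exec (RSet x i a) s (1 + ntime i + rtime a) (max (space s) (space s')) s'"
| Seq: "exec c1 s1 t1 m1 s2 \<Longrightarrow> exec c2 s2 t2 m2 s3 \<Longrightarrow>
    exec (Seq c1 c2) s1 (t1 + t2) (max m1 m2) s3"
| CondTrue: "bval b s \<Longrightarrow> exec c1 s t m s' \<Longrightarrow>
    exec (Cond b c1 c2) s (1 + btime b + t) m s'"
| CondFalse: "\<not> bval b s \<Longrightarrow> exec c2 s t m s' \<Longrightarrow>
    exec (Cond b c1 c2) s (1 + btime b + t) m s'"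
| WhileFalse: "\<not> bval b s \<Longrightarrow> exec (While b c) s (1 + btime b) (space s) s"
| WhileTrue: "bval b s1 \<Longrightarrow> exec c s1 t1 m1 s2 \<Longrightarrow> exec (While b c) s2 t2 m2 s3 \<Longrightarrow>
    exec (While b c) s1 (1 + btime b + t1 + t2) (max m1 m2) s3"

inductive_cases SkipE: "exec Skip s t m s'"
inductive_cases NSetE: "exec (NSet x i a) s t m s'"
inductive_cases RSetE: "exec (RSet x i a) s t m s'"
inductive_cases SeqE: "exec (Seq c1 c2) s t m s'"
inductive_cases CondE: "exec (Cond b c1 c2) s t m s'"
inductive_cases WhileE: "exec (While b c) s t m s'"

lemma exec_deterministic:
  "exec c s t m s' \<Longrightarrow> exec c s u k s'' \<Longrightarrow> t = u \<and> m = k \<and> s' = s''"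
proof (induction arbitrary: u k s'' rule: exec.induct)
  case Skip then show ?case by (auto elim: SkipE)
next
  case NSet then show ?case by (auto elim: NSetE)
next
  case RSet then show ?case by (auto elim: RSetE)
next
  case Seq from Seq.prems show ?case by (rule SeqE) (auto dest: Seq.IH)
next
  case CondTrue
  from CondTrue.prems show ?case
    by (rule CondE) (use CondTrue.hyps in \<open>auto dest: CondTrue.IH\<close>)
next
  case CondFalse
  from CondFalse.prems show ?case
    by (rule CondE) (use CondFalse.hyps in \<open>auto dest: CondFalse.IH\<close>)
next
  case WhileFalse
  from WhileFalse.prems show ?case by (rule WhileE) (use WhileFalse.hyps in auto)
next
  case WhileTrue
  from WhileTrue.prems show ?case
    by (rule WhileE) (use WhileTrue.hyps in \<open>auto dest!: WhileTrue.IH\<close>)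
qed

lemma finite_used_nset: "finite (used_n s) \<Longrightarrow> finite (used_n (nset x i k s))"
  by (rule finite_subset[of _ "insert (x, i) (used_n s)"])
     (auto simp: used_n_def nset_def split: if_splits)

lemma finite_used_rset: "finite (used_r s) \<Longrightarrow> finite (used_r (rset x i r s))"
  by (rule finite_subset[of _ "insert (x, i) (used_r s)"])
     (auto simp: used_r_def rset_def split: if_splits)

lemma exec_finite_used:
  "exec c s t m s' \<Longrightarrow> finite (used_n s) \<Longrightarrow> finite (used_r s) \<Longrightarrow>
     finite (used_n s') \<and> finite (used_r s')"
proof (induction rule: exec.induct)
  case (NSet s' x i s a)
  moreover have "used_r s' = used_r s" using NSet by (simp add: used_r_def nset_def)
  ultimately show ?case by (simp add: finite_used_nset)
next
  case (RSet s' x i s a)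
  moreover have "used_n s' = used_n s" using RSet by (simp add: used_n_def rset_def)
  ultimately show ?case by (simp add: finite_used_rset)
qed auto


section \<open>Energy games as inputs\<close>

text \<open>
  A game with node set \<open>{..<n}\<close> is given by \<open>n\<close>, the characteristic vector of \<open>VMax\<close>, the
  adjacency matrix and the weight matrix, both stored row by row; all other cells are \<open>0\<close>.
\<close>

definition input_state ::
  "nat \<Rightarrow> nat pair_pre_digraph \<Rightarrow> nat set \<Rightarrow> (nat \<times> nat \<Rightarrow> real) \<Rightarrow> state" where
  "input_state n G VMax w =
     \<lparr>nmem = (\<lambda>x i.
        if x = ''n'' \<and> i = 0 then n
        else if x = ''max'' \<and> i < n \<and> i \<in> VMax then 1
        else if x = ''adj'' \<and> i < n * n \<and> (i div n, i mod n) \<in> parcs G then 1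
        else 0),
      rmem = (\<lambda>x i.
        if x = ''w'' \<and> i < n * n \<and> (i div n, i mod n) \<in> parcs G then w (i div n, i mod n)
        else 0)\<rparr>"

lemma finite_used_input:
  "finite (used_n (input_state n G VMax w))" "finite (used_r (input_state n G VMax w))"
proof -
  let ?C = "{''n'', ''max'', ''adj'', ''w''} \<times> ({0} \<union> {..<n} \<union> {..<n * n})"
  have "used_n (input_state n G VMax w) \<subseteq> ?C" "used_r (input_state n G VMax w) \<subseteq> ?C"
    by (auto simp: used_n_def used_r_def input_state_def split: if_splits)
  then show "finite (used_n (input_state n G VMax w))" "finite (used_r (input_state n G VMax w))"
    by (auto intro: finite_subset)
qed

definition output_set :: "nat \<Rightarrow> state \<Rightarrow> nat set" where
  "output_set n s = {v. v < n \<and> nmem s ''win'' v = 1}"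

end

theory Submission
  imports Defs "HOL-Library.Product_Lexorder" "HOL-Library.Product_Plus"
begin

text \<open>
  The algorithm is a potential reduction in the style of Gurvich, Karzanov and Khachiyan. Every
  weight is perturbed by an infinitesimal, so that zero cycles become positive, and
  the weights reduced by a potential, called slacks, are maintained. Let \<open>D\<close> be the set of nodes
  from which Min can force the first nonzero slack to be negative; since there are no zero cycles,
  Max can force it to be positive from all other nodes. The potential on \<open>D\<close> is lowered
  until the slack of an edge between \<open>D\<close> and its complement reaches zero. If this
  never happens, \<open>D\<close> is the winning region of Min, its complement that of Max.

  To count the rounds, build \<open>D\<close> in layers by alternately closing under forced Max nodes and
  under Min nodes. The first layer that changes in a round shrinks if it is a Max layer and grows
  if it is a Min layer, so the sequence of layer sizes never repeats; by duality the same holds for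
  the complement of \<open>D\<close>. One of the two sets has at most \<open>n/2\<close> nodes, and a set of \<open>h\<close> nodes
  admits at most \<open>2^(h+1)\<close> sequences of layer sizes.
\<close>

section \<open>Alternating lexicographic comparison\<close>

text \<open>The infinitesimal does two jobs. Slacks around a cycle sum to the pair of its weight and
  its length, so the lexicographic sign decides cycles as Max's winning condition does. Its own
  potential decreases along zero edges, which gives the determinacy that the duality rests on.

  The layer argument alone does not bound the rounds. It fails when a bad node ceases to be bad, and
  a round may leave all layers as they were. The set of bad nodes only shrinks, and while the region
  stays put each round removes an active edge, that is, a border edge whose slack is being driven to
  zero. So each round gets a code: the number of bad nodes, which side is small, the set of layer
  sizes of that side, and the number of active edges. No code occurs twice.

  A set of sizes is enough because the sizes increase strictly until they are constant. The small
  side may switch between two rounds; the argument follows either side through all rounds, so only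
  the two ends of a stretch have to agree.\<close>

definition alt_less :: "(nat \<Rightarrow> nat) \<Rightarrow> (nat \<Rightarrow> nat) \<Rightarrow> bool" where
  "alt_less f g \<longleftrightarrow>
     (\<exists>i. (\<forall>j<i. f j = g j) \<and> (if even i then g i < f i else f i < g i))"

text \<open>Together with transitivity this is all that is used of the order: if every round keeps
  the layer sizes or moves them forward, they return to an earlier value only if they never
  moved.\<close>

lemma alt_less_irrefl: "\<not> alt_less f f"
  by (auto simp: alt_less_def)

lemma alt_less_trans:
  assumes "alt_less f g" "alt_less g h"
  shows "alt_less f h"
proof -
  obtain i where i: "\<forall>j<i. f j = g j" "if even i then g i < f i else f i < g i"
    using assms(1) by (auto simp: alt_less_def)
  obtain k where k: "\<forall>j<k. g j = h j" "if even k then h k < g k else g k < h k"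
    using assms(2) by (auto simp: alt_less_def)
  consider "i < k" | "k < i" | "i = k" by linarith
  then show ?thesis
  proof cases
    case 1
    with i k show ?thesis by (auto simp: alt_less_def intro!: exI[of _ i])
  next
    case 2
    with i k show ?thesis by (auto simp: alt_less_def intro!: exI[of _ k])
  next
    case 3
    with i k show ?thesis
      by (auto simp: alt_less_def intro!: exI[of _ i] split: if_splits)
  qed
qed

text \<open>Strict growth up to the first repetition, constancy from there on. Layer sizes have this
  shape because a layer equal to its successor is already the whole region.\<close>

definition stabilizing :: "(nat \<Rightarrow> nat) \<Rightarrow> bool" where
  "stabilizing f \<longleftrightarrow> mono f \<and> (\<forall>i j. f (Suc i) = f i \<longrightarrow> i \<le> j \<longrightarrow> f j = f i)"

lemma stabilizing_mono: "stabilizing f \<Longrightarrow> i \<le> j \<Longrightarrow> f i \<le> f j"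
  unfolding stabilizing_def by (blast dest: monoD)

lemma stabilizing_const: "stabilizing f \<Longrightarrow> f (Suc i) = f i \<Longrightarrow> i \<le> j \<Longrightarrow> f j = f i"
  unfolding stabilizing_def by blast

text \<open>Such a sequence lists its values in increasing order, so it is recovered from the set of
  them. This replaces sequences of sizes up to \<open>h\<close> by subsets of \<open>{..h}\<close>,
  of which there are \<open>2 ^ (h + 1)\<close>.\<close>

lemma stabilizing_range_eq:
  assumes f: "stabilizing f" and g: "stabilizing g" and eq: "range f = range g"
  shows "f = g"
proof -
  \<comment> \<open>Exchanging \<open>f\<close> and \<open>g\<close> gives the other inequality. If
    \<open>g\<close> has become constant, \<open>g i\<close> is the greatest value of the common
    range; otherwise \<open>g (Suc i)\<close> exceeds all values listed so far, so it occurs in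
    \<open>f\<close> after index \<open>i\<close>.\<close>
  have next_le: "f (Suc i) \<le> g (Suc i)"
    if h: "stabilizing f" "stabilizing g" "range f = range g" "\<forall>j\<le>i. f j = g j"
    for f g :: "nat \<Rightarrow> nat" and i
  proof (cases "g (Suc i) = g i")
    case True
    obtain j where j: "f (Suc i) = g j" using rangeI[of f "Suc i"] unfolding h(3) by auto
    have "g j \<le> g i"
    proof (cases "i \<le> j")
      case True
      then show ?thesis using stabilizing_const[OF h(2) \<open>g (Suc i) = g i\<close>, of j] by simp
    next
      case False
      then show ?thesis using stabilizing_mono[OF h(2)] by simp
    qed
    with j True show ?thesis by simp
  next
    case False
    obtain j where j: "g (Suc i) = f j" using rangeI[of g "Suc i"] unfolding h(3)[symmetric] by auto
    have "\<not> j \<le> i"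
    proof
      assume "j \<le> i"
      then have "g (Suc i) = g j" using j h(4) by simp
      also have "\<dots> \<le> g i" using stabilizing_mono[OF h(2) \<open>j \<le> i\<close>] .
      finally show False using False stabilizing_mono[OF h(2), of i "Suc i"] by simp
    qed
    then have "Suc i \<le> j" by simp
    then show ?thesis using j stabilizing_mono[OF h(1)] by simp
  qed
  have "\<forall>j\<le>i. f j = g j" for i
  proof (induction i)
    case 0
    obtain j where "f 0 = g j" using rangeI[of f 0] unfolding eq by auto
    moreover obtain k where "g 0 = f k" using rangeI[of g 0] unfolding eq[symmetric] by auto
    moreover have "f 0 \<le> f k" "g 0 \<le> g j" using stabilizing_mono[OF f] stabilizing_mono[OF g] by simp_all
    ultimately show ?case by simp
  next
    case (Suc i)
    have "f (Suc i) = g (Suc i)"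
      using next_le[OF f g eq Suc] next_le[OF g f eq[symmetric]] Suc by (simp add: order_antisym)
    with Suc show ?case by (simp add: le_Suc_eq)
  qed
  then show ?thesis by auto
qed

section \<open>Slacks and the forced region\<close>

text \<open>Slacks are arguments of the definitions and not a parameter, since they change in every
  round and are negated in the dual game. They live in any ordered abelian group, so that pairs can
  be used later. Min owns \<open>V - Mx\<close>.\<close>

locale slack_game =
  fixes V Mx :: "'v set" and E :: "'v \<Rightarrow> 'v \<Rightarrow> bool"
  assumes finite_V: "finite V"
    and Mx_subset: "Mx \<subseteq> V"
    and edge_in: "E v u \<Longrightarrow> v \<in> V \<and> u \<in> V"
begin

definition force_max :: "('v \<Rightarrow> 'v \<Rightarrow> 'a::linordered_ab_group_add) \<Rightarrow> 'v set \<Rightarrow> 'v set" where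
  "force_max s X = {v \<in> Mx. \<forall>u. E v u \<longrightarrow> s v u < 0 \<or> s v u = 0 \<and> u \<in> X}"

definition force_min :: "('v \<Rightarrow> 'v \<Rightarrow> 'a::linordered_ab_group_add) \<Rightarrow> 'v set \<Rightarrow> 'v set" where
  "force_min s X = {v \<in> V - Mx. \<exists>u. E v u \<and> (s v u < 0 \<or> s v u = 0 \<and> u \<in> X)}"

definition attr :: "('v \<Rightarrow> 'v \<Rightarrow> 'a::linordered_ab_group_add) \<Rightarrow> 'v set" where
  "attr s = lfp (\<lambda>X. force_max s X \<union> force_min s X)"

text \<open>Even layers are closed under forced Max nodes, odd ones under forced Min nodes; the
  parities match those of \<open>alt_less\<close>.\<close>

primrec layer :: "('v \<Rightarrow> 'v \<Rightarrow> 'a::linordered_ab_group_add) \<Rightarrow> nat \<Rightarrow> 'v set" where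
  "layer s 0 = lfp (force_max s)"
| "layer s (Suc i) =
     lfp (\<lambda>Y. layer s i \<union> (if even i then force_min s Y else force_max s Y))"

declare layer.simps [simp del]

text \<open>
  No node becomes bad in a round, and the alternating rule for the layers holds as long as none
  ceases to be bad. This is what makes a bipartite normal form of the game unnecessary.
\<close>

definition bad :: "('v \<Rightarrow> 'v \<Rightarrow> 'a::linordered_ab_group_add) \<Rightarrow> 'v set" where
  "bad s = {v \<in> V - Mx. \<exists>u. E v u \<and> s v u < 0} \<union> {v \<in> Mx. \<exists>u. E v u \<and> 0 < s v u}"

text \<open>Lowering the potential on the region raises the slacks of edges leaving it and lowers
  those of edges entering it. The active edges are the ones that thereby move towards zero; all
  other border edges move away from it.\<close>

definition active :: "('v \<Rightarrow> 'v \<Rightarrow> 'a::linordered_ab_group_add) \<Rightarrow> ('v \<times> 'v) set" where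
  "active s = {(v, u). E v u \<and>
     (v \<in> attr s \<and> u \<notin> attr s \<and> s v u < 0 \<or> v \<notin> attr s \<and> u \<in> attr s \<and> 0 < s v u)}"

definition shift ::
  "('v \<Rightarrow> 'v \<Rightarrow> 'a::linordered_ab_group_add) \<Rightarrow> 'a \<Rightarrow> 'v \<Rightarrow> 'v \<Rightarrow> 'a" where
  "shift s \<delta> v u =
     (if v \<in> attr s \<and> u \<notin> attr s then s v u + \<delta>
      else if v \<notin> attr s \<and> u \<in> attr s then s v u - \<delta> else s v u)"

definition room :: "('v \<Rightarrow> 'v \<Rightarrow> 'a::linordered_ab_group_add) \<Rightarrow> 'v \<Rightarrow> 'v \<Rightarrow> 'a" where
  "room s v u = (if v \<in> attr s then - s v u else s v u)"

text \<open>Without active edges this is the minimum of the empty set, an unspecified value. A shift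
  by it still yields reduced slacks, and nothing more is claimed about such a round.\<close>

definition gap :: "('v \<Rightarrow> 'v \<Rightarrow> 'a::linordered_ab_group_add) \<Rightarrow> 'a" where
  "gap s = Min ((\<lambda>(v, u). room s v u) ` active s)"

definition step :: "('v \<Rightarrow> 'v \<Rightarrow> 'a::linordered_ab_group_add) \<Rightarrow> 'v \<Rightarrow> 'v \<Rightarrow> 'a" where
  "step s = shift s (gap s)"

text \<open>A round as a relation between slacks on edges. The dual game performs the same round,
  but its \<open>shift\<close> agrees with the negated \<open>shift\<close> on edges only, so an
  equation between the \<open>step\<close> functions would be too strong.\<close>

definition advances :: "('v \<Rightarrow> 'v \<Rightarrow> 'a::linordered_ab_group_add) \<Rightarrow> ('v \<Rightarrow> 'v \<Rightarrow> 'a) \<Rightarrow> bool" where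
  "advances s s' \<longleftrightarrow> (\<exists>\<delta>>0. (\<forall>v u. E v u \<longrightarrow> s' v u = shift s \<delta> v u) \<and>
     (\<forall>v u. (v, u) \<in> active s \<longrightarrow> \<delta> \<le> room s v u) \<and>
     (\<exists>v u. (v, u) \<in> active s \<and> \<delta> = room s v u))"

lemma force_max_mono: "X \<subseteq> Y \<Longrightarrow> force_max s X \<subseteq> force_max s Y"
  by (auto simp: force_max_def)

lemma force_min_mono: "X \<subseteq> Y \<Longrightarrow> force_min s X \<subseteq> force_min s Y"
  by (auto simp: force_min_def)

lemma mono_force: "mono (\<lambda>X. force_max s X \<union> force_min s X)"
  by (intro monoI Un_mono force_max_mono force_min_mono)

lemma mono_layer: "mono (\<lambda>Y. Z \<union> (if even i then force_min s Y else force_max s Y))"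
  by (intro monoI Un_mono) (simp_all add: force_min_mono force_max_mono)

lemma mono_force_max: "mono (force_max s)"
  by (intro monoI force_max_mono)

lemma attr_unfold: "attr s = force_max s (attr s) \<union> force_min s (attr s)"
  unfolding attr_def by (rule lfp_unfold[OF mono_force])

lemma attr_lowerbound: "force_max s X \<union> force_min s X \<subseteq> X \<Longrightarrow> attr s \<subseteq> X"
  unfolding attr_def by (rule lfp_lowerbound)

lemma attr_subset: "attr s \<subseteq> V"
  using Mx_subset by (intro attr_lowerbound) (auto simp: force_max_def force_min_def)

lemma attr_max: "v \<in> Mx \<Longrightarrow> v \<in> attr s \<longleftrightarrow> (\<forall>u. E v u \<longrightarrow> s v u < 0 \<or> s v u = 0 \<and> u \<in> attr s)"
  by (subst attr_unfold) (auto simp: force_max_def force_min_def)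

lemma attr_min:
  "v \<in> V - Mx \<Longrightarrow> v \<in> attr s \<longleftrightarrow> (\<exists>u. E v u \<and> (s v u < 0 \<or> s v u = 0 \<and> u \<in> attr s))"
  by (subst attr_unfold) (auto simp: force_max_def force_min_def)

lemma layer_0_unfold: "layer s 0 = force_max s (layer s 0)"
  unfolding layer.simps by (rule lfp_unfold[OF mono_force_max])

lemma layer_Suc_unfold:
  "layer s (Suc i) = layer s i \<union>
     (if even i then force_min s (layer s (Suc i)) else force_max s (layer s (Suc i)))"
  unfolding layer.simps by (rule lfp_unfold[OF mono_layer])

lemma layer_Suc_mono: "layer s i \<subseteq> layer s (Suc i)"
  by (subst layer_Suc_unfold) auto

lemma layer_mono: "i \<le> j \<Longrightarrow> layer s i \<subseteq> layer s j"
  using lift_Suc_mono_le[of "layer s", OF layer_Suc_mono] .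

lemma layer_even_closed: "even i \<Longrightarrow> force_max s (layer s i) \<subseteq> layer s i"
proof (cases i)
  case 0
  then show ?thesis using layer_0_unfold[of s] by auto
next
  case (Suc j)
  assume "even i"
  with Suc show ?thesis using layer_Suc_unfold[of s j] by auto
qed

lemma layer_odd_closed: "odd i \<Longrightarrow> force_min s (layer s i) \<subseteq> layer s i"
  using layer_Suc_unfold[of s "i - 1"] by (cases i) auto

lemma layer_subset_attr: "layer s i \<subseteq> attr s"
proof (induction i)
  case 0
  show ?case unfolding layer.simps using attr_unfold[of s] by (intro lfp_lowerbound) auto
next
  case (Suc i)
  then show ?case using attr_unfold[of s] unfolding layer.simps
    by (intro lfp_lowerbound) (auto split: if_splits)
qed

text \<open>Two consecutive layers have different parity, so if they coincide, the set is closed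
  under both kinds of forcing, and the region is the least such set.\<close>

lemma attr_subset_layer: "layer s (Suc i) = layer s i \<Longrightarrow> attr s \<subseteq> layer s i"
  using layer_even_closed[of i s] layer_odd_closed[of i s]
    layer_even_closed[of "Suc i" s] layer_odd_closed[of "Suc i" s]
  by (intro attr_lowerbound) (cases "even i"; auto)

lemma layer_stable:
  assumes "layer s (Suc i) = layer s i" "i \<le> j"
  shows "layer s j = layer s i"
  using attr_subset_layer[OF assms(1)] layer_subset_attr[of s j] layer_mono[OF assms(2), of s]
  by blast

lemma finite_attr: "finite (attr s)"
  using finite_subset[OF attr_subset finite_V] .

lemma finite_layer: "finite (layer s i)"
  using finite_subset[OF layer_subset_attr finite_attr] .

lemma stabilizing_layer: "stabilizing (\<lambda>i. card (layer s i))"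
proof -
  have "card (layer s j) = card (layer s i)"
    if "card (layer s (Suc i)) = card (layer s i)" "i \<le> j" for i j
  proof -
    have "layer s (Suc i) = layer s i"
      using card_subset_eq[OF finite_layer layer_Suc_mono[of s i]] that(1) by simp
    then show ?thesis using layer_stable that(2) by metis
  qed
  moreover have "mono (\<lambda>i. card (layer s i))"
    by (intro monoI card_mono finite_layer layer_mono)
  ultimately show ?thesis unfolding stabilizing_def by blast
qed

lemma attr_eq_Union_layer: "attr s = (\<Union>i. layer s i)"
proof
  show "(\<Union>i. layer s i) \<subseteq> attr s" using layer_subset_attr by blast
  have "\<exists>i. layer s (Suc i) = layer s i"
  proof (rule ccontr)
    assume neq: "\<nexists>i. layer s (Suc i) = layer s i"
    have "i \<le> card (layer s i)" for i
    proof (induction i)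
      case (Suc i)
      have "layer s i \<subset> layer s (Suc i)" using neq layer_Suc_mono[of s i] by blast
      then have "card (layer s i) < card (layer s (Suc i))"
        using finite_layer psubset_card_mono by blast
      with Suc show ?case by simp
    qed simp
    from this[of "Suc (card (attr s))"] card_mono[OF finite_attr layer_subset_attr]
    show False using Suc_n_not_le_n le_trans by blast
  qed
  then show "attr s \<subseteq> (\<Union>i. layer s i)" using attr_subset_layer by blast
qed

lemma range_layer: "range (\<lambda>i. card (layer s i)) \<subseteq> {..card (attr s)}"
  using card_mono[OF finite_attr layer_subset_attr] by auto

section \<open>Effect of one round on bad nodes, active edges and layers\<close>

lemma bad_advances:
  assumes "advances s s'"
  shows "bad s' \<subseteq> bad s"
proof
  fix v assume v: "v \<in> bad s'"
  obtain \<delta> where \<delta>: "0 < \<delta>" "\<And>v u. E v u \<Longrightarrow> s' v u = shift s \<delta> v u"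
    "\<And>v u. (v, u) \<in> active s \<Longrightarrow> \<delta> \<le> room s v u"
    using assms unfolding advances_def by metis
  consider u where "v \<in> V - Mx" "E v u" "s' v u < 0" | u where "v \<in> Mx" "E v u" "0 < s' v u"
    using v by (auto simp: bad_def)
  then show "v \<in> bad s"
  proof cases
    case 1
    \<comment> \<open>Only on an edge entering the region can a nonnegative slack turn negative. The
      slack is not zero there, as a zero edge into the region would put \<open>v\<close> inside, so
      the edge is active and has room for \<delta>.\<close>
    have "s v u < 0"
    proof (rule ccontr)
      assume "\<not> s v u < 0"
      then have ge: "0 \<le> s v u" by simp
      have s': "s' v u = shift s \<delta> v u" using 1(2) by (rule \<delta>(2))
      have in_out: "v \<notin> attr s" "u \<in> attr s"
        using s' 1(3) ge add_nonneg_nonneg[OF ge less_imp_le[OF \<delta>(1)]]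
        by (auto simp: shift_def split: if_splits)
      then have "s v u < \<delta>" using s' 1(3) by (simp add: shift_def)
      moreover have "s v u \<noteq> 0" using attr_min[OF 1(1), of s] 1(2) in_out by auto
      ultimately have "(v, u) \<in> active s" using ge 1 in_out by (simp add: active_def)
      then show False using \<delta>(3)[of v u] in_out \<open>s v u < \<delta>\<close> by (simp add: room_def)
    qed
    with 1 show ?thesis by (auto simp: bad_def)
  next
    case 2
    have "0 < s v u"
    proof (rule ccontr)
      assume "\<not> 0 < s v u"
      then have le: "s v u \<le> 0" by simp
      have s': "s' v u = shift s \<delta> v u" using 2(2) by (rule \<delta>(2))
      have in_out: "v \<in> attr s" "u \<notin> attr s"
        using s' 2(3) le order_trans[OF le less_imp_le[OF \<delta>(1)]]
        by (auto simp: shift_def split: if_splits)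
      then have "- s v u < \<delta>"
        using s' 2(3) diff_less_eq[of 0 "s v u" \<delta>] by (simp add: shift_def add.commute)
      moreover have "s v u \<noteq> 0" using attr_max[OF 2(1), of s] 2(2) in_out by auto
      ultimately have "(v, u) \<in> active s" using le 2 in_out by (simp add: active_def)
      then show False using \<delta>(3)[of v u] in_out \<open>- s v u < \<delta>\<close> by (simp add: room_def)
    qed
    with 2 show ?thesis by (auto simp: bad_def)
  qed
qed


text \<open>With the region fixed, border edges keep their direction of movement, so none becomes
  active, and the edge whose room is \<delta> reaches zero. This measures progress in rounds that
  leave the layers alone.\<close>

lemma active_advances:
  assumes "advances s s'" "attr s' = attr s"
  shows "active s' \<subset> active s"
proof -
  obtain \<delta> v u where \<delta>: "0 < \<delta>" "\<And>v u. E v u \<Longrightarrow> s' v u = shift s \<delta> v u"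
    and vu: "(v, u) \<in> active s" "\<delta> = room s v u"
    using assms unfolding advances_def by metis
  have E: "E v u" if "(v, u) \<in> active t" for v u t
    using that by (simp add: active_def)
  have "active s' \<subseteq> active s"
  proof (rule subrelI)
    fix v u assume vu: "(v, u) \<in> active s'"
    then have s': "s' v u = shift s \<delta> v u" using \<delta>(2) E by blast
    from vu consider "v \<in> attr s" "u \<notin> attr s" "s' v u < 0" "E v u"
      | "v \<notin> attr s" "u \<in> attr s" "0 < s' v u" "E v u"
      by (auto simp: active_def assms(2))
    then show "(v, u) \<in> active s"
    proof cases
      case 1
      then have "s v u + \<delta> < 0" using s' by (simp add: shift_def)
      then have "s v u < 0" using less_trans[OF add_strict_left_mono[OF \<delta>(1), of "s v u"]] by simp
      then show ?thesis using 1 by (simp add: active_def)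
    next
      case 2
      then have "0 < s v u - \<delta>" using s' by (simp add: shift_def)
      then have "0 < s v u" using \<delta>(1) by (meson diff_gt_0_iff_gt less_trans)
      then show ?thesis using 2 by (simp add: active_def)
    qed
  qed
  moreover have "(v, u) \<notin> active s'"
    using \<delta>(2)[OF E[OF vu(1)]] vu
    by (auto simp: active_def assms(2) shift_def room_def split: if_splits)
  ultimately show ?thesis using vu by blast
qed

text \<open>Growth would need a newly forced Max node. Outside the region, such a node has a
  positive edge, hence still some positive edge by equality of the bad sets, or a zero edge that
  stays outside and is unchanged; either prevents forcing. Inside the region, edges that stay inside
  are unchanged, and edges that leave it were negative already.\<close>

lemma layer_even_advances:
  assumes adv: "advances s s'" and bad: "bad s' = bad s" and "even i"
    and prev: "\<And>j. j < i \<Longrightarrow> layer s' j = layer s j"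
  shows "layer s' i \<subseteq> layer s i"
proof -
  obtain \<delta> where \<delta>: "0 < \<delta>" "\<And>v u. E v u \<Longrightarrow> s' v u = shift s \<delta> v u"
    "\<And>v u. (v, u) \<in> active s \<Longrightarrow> \<delta> \<le> room s v u"
    using adv unfolding advances_def by metis
  have sub: "force_max s' (layer s i) \<subseteq> force_max s (layer s i)"
  proof
    fix v assume "v \<in> force_max s' (layer s i)"
    then have v: "v \<in> Mx" "\<And>u. E v u \<Longrightarrow> s' v u < 0 \<or> s' v u = 0 \<and> u \<in> layer s i"
      by (auto simp: force_max_def)
    have "v \<in> attr s"
    proof (rule ccontr)
      assume vn: "v \<notin> attr s"
      then obtain u where u: "E v u" "0 \<le> s v u" "s v u = 0 \<Longrightarrow> u \<notin> attr s"
        using attr_max[OF v(1), of s] by force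
      show False
      proof (cases "s v u = 0")
        case True
        then have "s' v u = 0" "u \<notin> layer s i"
          using \<delta>(2)[OF u(1)] u(3) vn layer_subset_attr[of s i] by (auto simp: shift_def)
        then show False using v(2)[OF u(1)] by simp
      next
        case False
        \<comment> \<open>The positive edge at hand may itself have dropped to zero; equality of the
          bad sets supplies one that is positive after the round.\<close>
        then have "v \<in> bad s'" using u v(1) bad by (auto simp: bad_def)
        then obtain u' where "E v u'" "0 < s' v u'" using v(1) by (auto simp: bad_def)
        then show False using v(2)[of u'] by auto
      qed
    qed
    have "s v u < 0 \<or> s v u = 0 \<and> u \<in> layer s i" if "E v u" for u
    proof (cases "u \<in> attr s")
      case True
      then have "s' v u = s v u" using \<delta>(2)[OF that] \<open>v \<in> attr s\<close> by (simp add: shift_def)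
      then show ?thesis using v(2)[OF that] by simp
    next
      case False
      then show ?thesis using attr_max[OF v(1), of s] \<open>v \<in> attr s\<close> that by blast
    qed
    then show "v \<in> force_max s (layer s i)" using v(1) by (simp add: force_max_def)
  qed
  then have closed: "force_max s' (layer s i) \<subseteq> layer s i"
    using layer_even_closed[OF \<open>even i\<close>, of s] by blast
  show ?thesis
  proof (cases i)
    case 0
    then show ?thesis using closed lfp_lowerbound[of "force_max s'" "layer s 0"]
      by (simp add: layer.simps(1)[of s'])
  next
    case (Suc j)
    then have "odd j" using \<open>even i\<close> by simp
    have "layer s' j \<subseteq> layer s i" using prev[of j] layer_Suc_mono[of s j] Suc by simp
    then show ?thesis unfolding Suc layer.simps(2)[of s']
      by (intro lfp_lowerbound) (use closed \<open>odd j\<close> Suc in auto)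
  qed
qed

lemma layer_odd_advances:
  assumes adv: "advances s s'" and bad: "bad s' = bad s" and "odd i"
    and prev: "\<And>j. j < i \<Longrightarrow> layer s' j = layer s j"
  shows "layer s i \<subseteq> layer s' i"
proof -
  obtain \<delta> where \<delta>: "0 < \<delta>" "\<And>v u. E v u \<Longrightarrow> s' v u = shift s \<delta> v u"
    "\<And>v u. (v, u) \<in> active s \<Longrightarrow> \<delta> \<le> room s v u"
    using adv unfolding advances_def by metis
  obtain j where j: "i = Suc j" "even j" using \<open>odd i\<close> by (cases i) auto
  \<comment> \<open>The intersection gives the head of a zero edge both properties needed: it lies
    in the old region, so the round keeps this slack at zero, and it lies in the new layer, so the
    edge still forces \<open>v\<close>.\<close>
  let ?Y = "layer s i \<inter> layer s' i"
  have "layer s j \<union> force_min s ?Y \<subseteq> ?Y"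
  proof
    fix v assume "v \<in> layer s j \<union> force_min s ?Y"
    then show "v \<in> ?Y"
    proof
      assume "v \<in> layer s j"
      then show ?thesis
        using prev[of j] layer_Suc_mono[of s j] layer_Suc_mono[of s' j] j by auto
    next
      assume v: "v \<in> force_min s ?Y"
      then have vi: "v \<in> layer s i"
        using force_min_mono[of ?Y "layer s i" s] layer_odd_closed[OF \<open>odd i\<close>, of s] by auto
      have va: "v \<in> attr s" using vi layer_subset_attr by blast
      from v obtain u where vm: "v \<in> V - Mx" and u: "E v u" "s v u < 0 \<or> s v u = 0 \<and> u \<in> ?Y"
        by (auto simp: force_min_def)
      have "v \<in> force_min s' (layer s' i)"
      proof (cases "s v u < 0")
        case True
        then have "v \<in> bad s'" using u(1) vm bad by (auto simp: bad_def)
        then show ?thesis using vm by (auto simp: bad_def force_min_def)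
      next
        case False
        then have "s v u = 0" "u \<in> layer s' i" "u \<in> attr s"
          using u(2) layer_subset_attr by blast+
        then have "s' v u = 0" using \<delta>(2)[OF u(1)] va by (simp add: shift_def)
        then show ?thesis using vm u(1) \<open>u \<in> layer s' i\<close> by (auto simp: force_min_def)
      qed
      then show ?thesis using vi layer_odd_closed[OF \<open>odd i\<close>, of s'] by blast
    qed
  qed
  then have "lfp (\<lambda>Y. layer s j \<union> force_min s Y) \<subseteq> ?Y" by (rule lfp_lowerbound)
  then have "layer s i \<subseteq> ?Y" using j by (simp add: layer.simps(2)[of s])
  then show ?thesis by blast
qed

lemma layer_advances:
  assumes adv: "advances s s'" and bad: "bad s' = bad s"
  shows "attr s' = attr s \<and> layer s' = layer s \<or>
    alt_less (\<lambda>i. card (layer s i)) (\<lambda>i. card (layer s' i))"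
proof (cases "layer s' = layer s")
  case True
  then show ?thesis by (simp add: attr_eq_Union_layer)
next
  case False
  then obtain k where "layer s' k \<noteq> layer s k" by (meson ext)
  then obtain i where neq: "layer s' i \<noteq> layer s i"
    and prev: "\<And>j. j < i \<Longrightarrow> layer s' j = layer s j"
    using exists_least_iff[of "\<lambda>i. layer s' i \<noteq> layer s i"] by blast
  have "if even i then layer s' i \<subset> layer s i else layer s i \<subset> layer s' i"
    using layer_even_advances[OF adv bad _ prev] layer_odd_advances[OF adv bad _ prev] neq by auto
  then have "if even i then card (layer s' i) < card (layer s i) else card (layer s i) < card (layer s' i)"
    by (auto intro!: psubset_card_mono finite_layer split: if_splits)
  then have "alt_less (\<lambda>i. card (layer s i)) (\<lambda>i. card (layer s' i))"
    unfolding alt_less_def using prev by (intro exI[of _ i]) simp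
  then show ?thesis ..
qed

lemma advances_step:
  assumes "active s \<noteq> {}"
  shows "advances s (step s)"
proof -
  let ?A = "(\<lambda>(v, u). room s v u) ` active s"
  have "active s \<subseteq> V \<times> V" by (auto simp: active_def edge_in)
  then have fin: "finite ?A" using finite_V by (auto intro!: finite_imageI intro: finite_subset)
  have ne: "?A \<noteq> {}" using assms by simp
  have "gap s \<in> ?A" unfolding gap_def by (rule Min_in[OF fin ne])
  moreover from this have "0 < gap s" by (auto simp: active_def room_def)
  moreover have "gap s \<le> room s v u" if "(v, u) \<in> active s" for v u
    unfolding gap_def using that by (intro Min_le[OF fin]) force
  ultimately show ?thesis by (auto simp: advances_def step_def intro!: exI[of _ "gap s"])
qed


section \<open>Stretches of rounds that keep the number of bad nodes\<close>

lemma finite_active: "finite (active s)"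
  by (rule finite_subset[of _ "V \<times> V"]) (auto simp: active_def edge_in finite_V)

lemma finite_bad: "finite (bad s)"
  by (rule finite_subset[OF _ finite_V]) (use Mx_subset in \<open>auto simp: bad_def\<close>)

text \<open>Bad sets are nested, so equal cardinalities at the ends freeze them throughout. The
  sizes then only move forward in \<open>alt_less\<close>, and equal value sets at the ends mean
  that they never moved. So the region was fixed, and every round lost an active edge.\<close>

lemma advances_chain:
  fixes S :: "nat \<Rightarrow> 'v \<Rightarrow> 'v \<Rightarrow> 'a::linordered_ab_group_add"
  assumes adv: "\<And>k. i \<le> k \<Longrightarrow> k < j \<Longrightarrow> advances (S k) (S (Suc k))" and "i < j"
    and bad: "card (bad (S j)) = card (bad (S i))"
    and range: "range (\<lambda>l. card (layer (S j) l)) = range (\<lambda>l. card (layer (S i) l))"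
  shows "card (active (S j)) < card (active (S i))"
proof -
  let ?L = "\<lambda>k l. card (layer (S k) l)"
  have bad_le: "bad (S l) \<subseteq> bad (S k)" if "i \<le> k" "k \<le> l" "l \<le> j" for k l
    using that(2,3)
  proof (induction l rule: dec_induct)
    case (step m)
    then show ?case using bad_advances[OF adv[of m]] that(1) by auto
  qed simp
  have bad_eq: "bad (S k) = bad (S i)" if "i \<le> k" "k \<le> j" for k
    using card_subset_eq[OF finite_bad bad_le[of i j]] bad_le[of i k] bad_le[of k j] that bad \<open>i < j\<close>
    by auto
  \<comment> \<open>Once the sizes have moved they stay strictly ahead of those at \<open>i\<close>;
    until then the layers themselves are unchanged.\<close>
  let ?P = "\<lambda>k. attr (S k) = attr (S i) \<and> layer (S k) = layer (S i) \<and>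
    active (S k) \<subseteq> active (S i) \<and> (i < k \<longrightarrow> active (S k) \<subset> active (S i))"
  have "?P k \<or> alt_less (?L i) (?L k)" if "i \<le> k" "k \<le> j" for k
    using that
  proof (induction k rule: dec_induct)
    case (step k)
    have a: "advances (S k) (S (Suc k))" using adv step by simp
    have b: "bad (S (Suc k)) = bad (S k)" using bad_eq[of k] bad_eq[of "Suc k"] step by simp
    have IH: "?P k \<or> alt_less (?L i) (?L k)" using step by simp
    from layer_advances[OF a b] show ?case
    proof
      assume h: "attr (S (Suc k)) = attr (S k) \<and> layer (S (Suc k)) = layer (S k)"
      have "active (S (Suc k)) \<subset> active (S k)" using active_advances[OF a] h by blast
      then have "?P (Suc k)" if "?P k" using that h by auto
      moreover have "alt_less (?L i) (?L (Suc k))" if "alt_less (?L i) (?L k)" using that h by simp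
      ultimately show ?thesis using IH by blast
    next
      assume h: "alt_less (?L k) (?L (Suc k))"
      have "alt_less (?L i) (?L (Suc k))" if "layer (S k) = layer (S i)" using that h by simp
      then show ?thesis using IH alt_less_trans[OF _ h, of "?L i"] by blast
    qed
  qed simp
  moreover have "?L j = ?L i"
    using stabilizing_range_eq[OF stabilizing_layer stabilizing_layer range] .
  ultimately have "active (S j) \<subset> active (S i)"
    using \<open>i < j\<close> alt_less_irrefl[of "?L i"] by (metis less_imp_le_nat order_refl)
  then show ?thesis using finite_active psubset_card_mono by blast
qed

section \<open>Exchanging the players\<close>

lemma slack_game_dual: "slack_game V (V - Mx) E"
  by unfold_locales (use finite_V edge_in in auto)

lemma Diff_Diff_Mx: "V - (V - Mx) = Mx"
  using Mx_subset by auto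

text \<open>\<open>z\<close> decreases along zero edges, so these form no cycle. A node claimed by
  neither player would have a zero edge to another such node, which is impossible for the one with
  the least \<open>z\<close>.\<close>

lemma attr_dual:
  fixes z :: "'v \<Rightarrow> 'b::linorder"
  assumes z: "\<And>v u. E v u \<Longrightarrow> s v u = 0 \<Longrightarrow> z u < z v"
  shows "slack_game.attr V (V - Mx) E (\<lambda>v u. - s v u) = V - attr s"
proof -
  interpret dual: slack_game V "V - Mx" E by (rule slack_game_dual)
  let ?s = "\<lambda>v u. - s v u"
  have dmin: "v \<in> dual.attr ?s \<longleftrightarrow> (\<forall>u. E v u \<longrightarrow> 0 < s v u \<or> s v u = 0 \<and> u \<in> dual.attr ?s)"
    if "v \<in> V - Mx" for v using dual.attr_max[of v ?s] that by simp
  have dmax: "v \<in> dual.attr ?s \<longleftrightarrow> (\<exists>u. E v u \<and> (0 < s v u \<or> s v u = 0 \<and> u \<in> dual.attr ?s))"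
    if "v \<in> Mx" for v using dual.attr_min[of v ?s] that Mx_subset by auto
  have "dual.attr ?s \<subseteq> V - attr s"
  proof (rule dual.attr_lowerbound, rule subsetI)
    fix v assume v: "v \<in> dual.force_max ?s (V - attr s) \<union> dual.force_min ?s (V - attr s)"
    show "v \<in> V - attr s"
    proof (cases "v \<in> Mx")
      case True
      then show ?thesis using v attr_max[OF True, of s] Mx_subset
        by (force simp: dual.force_max_def dual.force_min_def)
    next
      case False
      then have "v \<in> V - Mx" using v by (auto simp: dual.force_max_def dual.force_min_def)
      then show ?thesis using v attr_min[of v s]
        by (force simp: dual.force_max_def dual.force_min_def)
    qed
  qed
  moreover have "V - attr s \<subseteq> dual.attr ?s"
  proof (rule ccontr)
    define Q where "Q = V - attr s - dual.attr ?s"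
    assume "\<not> V - attr s \<subseteq> dual.attr ?s"
    then have "Q \<noteq> {}" "finite Q" using finite_V by (auto simp: Q_def)
    then have m: "Min (z ` Q) \<in> z ` Q" by (intro Min_in) auto
    then obtain v where v: "v \<in> Q" "z v = Min (z ` Q)" by auto
    have "\<exists>u. E v u \<and> s v u = 0 \<and> u \<in> Q"
    proof (cases "v \<in> Mx")
      case True
      then obtain u where u: "E v u" "\<not> (s v u < 0 \<or> s v u = 0 \<and> u \<in> attr s)"
        using attr_max[OF True, of s] v(1) by (auto simp: Q_def)
      then show ?thesis using dmax[OF True] v(1) edge_in[OF u(1)] by (force simp: Q_def)
    next
      case False
      then have vm: "v \<in> V - Mx" using v(1) by (simp add: Q_def)
      then obtain u where u: "E v u" "\<not> (0 < s v u \<or> s v u = 0 \<and> u \<in> dual.attr ?s)"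
        using dmin[OF vm] v(1) by (auto simp: Q_def)
      then show ?thesis using attr_min[OF vm, of s] v(1) edge_in[OF u(1)] by (force simp: Q_def)
    qed
    then obtain u where "z u < z v" "u \<in> Q" using z by blast
    then show False using v(2) \<open>finite Q\<close> by (metis Min_le finite_imageI imageI not_less)
  qed
  ultimately show ?thesis by blast
qed

lemma active_dual:
  fixes z :: "'v \<Rightarrow> 'b::linorder"
  assumes z: "\<And>v u. E v u \<Longrightarrow> s v u = 0 \<Longrightarrow> z u < z v"
  shows "slack_game.active V (V - Mx) E (\<lambda>v u. - s v u) = active s"
proof -
  interpret dual: slack_game V "V - Mx" E by (rule slack_game_dual)
  show ?thesis using attr_dual[of s z, OF z]
    by (auto simp: active_def dual.active_def dest: edge_in)
qed

text \<open>Negation together with the exchange of owners swaps the two parts of \<open>bad\<close>,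
  so both sides share one count of bad nodes.\<close>

lemma bad_dual: "slack_game.bad V (V - Mx) E (\<lambda>v u. - s v u) = bad s"
proof -
  interpret dual: slack_game V "V - Mx" E by (rule slack_game_dual)
  show ?thesis by (auto simp: bad_def dual.bad_def Diff_Diff_Mx)
qed

lemma advances_dual:
  fixes z :: "'v \<Rightarrow> 'b::linorder"
  assumes z: "\<And>v u. E v u \<Longrightarrow> s v u = 0 \<Longrightarrow> z u < z v" and adv: "advances s s'"
  shows "slack_game.advances V (V - Mx) E (\<lambda>v u. - s v u) (\<lambda>v u. - s' v u)"
proof -
  interpret dual: slack_game V "V - Mx" E by (rule slack_game_dual)
  have shift: "dual.shift (\<lambda>v u. - s v u) \<delta> v u = - shift s \<delta> v u" if "E v u" for \<delta> v u
    using edge_in[OF that] attr_dual[of s z, OF z] by (simp add: shift_def dual.shift_def)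
  have room: "dual.room (\<lambda>v u. - s v u) v u = room s v u" if "(v, u) \<in> active s" for v u
    using edge_in[of v u] that attr_dual[of s z, OF z]
    by (simp add: room_def dual.room_def active_def)
  obtain \<delta> v u where \<delta>: "0 < \<delta>" "\<And>v u. E v u \<Longrightarrow> s' v u = shift s \<delta> v u"
    "\<And>v u. (v, u) \<in> active s \<Longrightarrow> \<delta> \<le> room s v u" "(v, u) \<in> active s" "\<delta> = room s v u"
    using adv unfolding advances_def by metis
  have "\<exists>v u. (v, u) \<in> active s \<and> \<delta> = dual.room (\<lambda>v u. - s v u) v u"
    using room[OF \<delta>(4)] \<delta>(4,5) by metis
  moreover have "\<forall>v u. (v, u) \<in> active s \<longrightarrow> \<delta> \<le> dual.room (\<lambda>v u. - s v u) v u"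
    using room \<delta>(3) by simp
  moreover have "\<forall>v u. E v u \<longrightarrow> - s' v u = dual.shift (\<lambda>v u. - s v u) \<delta> v u"
    using shift \<delta>(2) by simp
  moreover have "dual.active (\<lambda>v u. - s v u) = active s"
    by (rule active_dual[of s z]) (rule z)
  ultimately show ?thesis
    unfolding dual.advances_def using \<delta>(1) by simp blast
qed

text \<open>The four factors count the values of the four parts of a code: the number of bad nodes,
  the choice of the small side, the set of layer sizes, the number of active edges.\<close>

theorem active_eventually_empty:
  fixes S :: "nat \<Rightarrow> 'v \<Rightarrow> 'v \<Rightarrow> 'a::linordered_ab_group_add" and z :: "nat \<Rightarrow> 'v \<Rightarrow> 'b::linorder"
  assumes S: "\<And>k. S (Suc k) = step (S k)"
    and z: "\<And>k v u. E v u \<Longrightarrow> S k v u = 0 \<Longrightarrow> z k u < z k v"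
  shows "\<exists>k < (card V + 1) * (2 * (2 ^ (card V div 2 + 1) * (card V * card V + 1))). active (S k) = {}"
proof (rule ccontr)
  interpret dual: slack_game V "V - Mx" E by (rule slack_game_dual)
  let ?h = "card V div 2"
  let ?B = "(card V + 1) * (2 * (2 ^ (?h + 1) * (card V * card V + 1)))"
  assume "\<not> (\<exists>k < ?B. active (S k) = {})"
  then have adv: "advances (S k) (S (Suc k))" if "k < ?B" for k
    using that advances_step S by metis
  define T where "T k = (\<lambda>v u. - S k v u)" for k
  have dual_adv: "dual.advances (T k) (T (Suc k))" if "k < ?B" for k
    unfolding T_def by (rule advances_dual[of "S k" "z k"]) (use z adv[OF that] in auto)
  have dual_attr: "dual.attr (T k) = V - attr (S k)" for k
    unfolding T_def by (rule attr_dual[of "S k" "z k"]) (rule z)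
  have dual_active: "dual.active (T k) = active (S k)" for k
    unfolding T_def by (rule active_dual[of "S k" "z k"]) (rule z)
  define small where "small k \<longleftrightarrow> card (attr (S k)) \<le> ?h" for k
  define sizes where "sizes k = (if small k then range (\<lambda>l. card (layer (S k) l))
    else range (\<lambda>l. card (dual.layer (T k) l)))" for k
  let ?code = "\<lambda>k. (card (bad (S k)), small k, sizes k, card (active (S k)))"
  let ?C = "{..card V} \<times> (UNIV :: bool set) \<times> Pow {..?h} \<times> {..card V * card V}"
  have "?code k \<in> ?C" for k
  proof -
    have "card (bad (S k)) \<le> card V"
      by (rule card_mono[OF finite_V]) (use Mx_subset in \<open>auto simp: bad_def\<close>)
    moreover have "card (active (S k)) \<le> card (V \<times> V)"
      by (rule card_mono) (auto simp: active_def edge_in finite_V)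
    moreover have "sizes k \<subseteq> {..?h}"
    proof (cases "small k")
      case True
      then show ?thesis using range_layer[of "S k"] by (auto simp: sizes_def small_def)
    next
      case False
      have "card (dual.attr (T k)) = card V - card (attr (S k))"
        unfolding dual_attr
        by (rule card_Diff_subset[OF finite_attr attr_subset])
      then have "card (dual.attr (T k)) \<le> ?h" using False by (simp add: small_def)
      then show ?thesis using False dual.range_layer[of "T k"] by (auto simp: sizes_def)
    qed
    ultimately show ?thesis by (simp add: card_cartesian_product)
  qed
  then have "?code ` {..<Suc ?B} \<subseteq> ?C" by blast
  \<comment> \<open>\<open>?B\<close> rounds with an active edge pass through \<open>?B + 1\<close>
    slack functions, one more than there are codes.\<close>
  moreover have "inj_on ?code {..<?B + 1}"
  proof (rule linorder_inj_onI')
    fix i j assume ij: "i \<in> {..<?B + 1}" "j \<in> {..<?B + 1}" "i < j"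
    show "?code i \<noteq> ?code j"
    proof
      assume eq: "?code i = ?code j"
      \<comment> \<open>The small side may have alternated between \<open>i\<close> and
        \<open>j\<close>. This does no harm, as the rounds in between advance in both the game and
        its dual.\<close>
      show False
      proof (cases "small i")
        case True
        then have "card (active (S j)) < card (active (S i))"
          using eq ij adv by (intro advances_chain) (auto simp: sizes_def)
        then show False using eq by simp
      next
        case False
        then have "card (dual.active (T j)) < card (dual.active (T i))"
          using eq ij dual_adv
          by (intro dual.advances_chain) (auto simp: sizes_def T_def bad_dual)
        then show False using eq by (simp add: dual_active)
      qed
    qed
  qed
  ultimately have "card {..<?B + 1} \<le> card ?C"
    by (intro card_inj_on_le[of ?code]) auto
  also have "card ?C = ?B" by (simp add: card_cartesian_product card_Pow card_UNIV_bool)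
  finally show False by simp
qed

end

section \<open>Correctness of the final region\<close>

instance prod :: (linordered_ab_group_add, linordered_ab_group_add) linordered_ab_group_add
  by standard (auto simp: less_eq_prod_def)

text \<open>
  The second component of a slack is the coefficient of the infinitesimal perturbation, which
  starts as \<open>1\<close> on every edge; pairs are ordered lexicographically.
\<close>

definition reduced_slack ::
  "'v pair_pre_digraph \<Rightarrow> ('v \<times> 'v \<Rightarrow> real) \<Rightarrow> ('v \<Rightarrow> real) \<Rightarrow> ('v \<Rightarrow> real) \<Rightarrow>
     ('v \<Rightarrow> 'v \<Rightarrow> real \<times> real) \<Rightarrow> bool" where
  "reduced_slack G w x z s \<longleftrightarrow>
     (\<forall>(v, u)\<in>parcs G. s v u = (w (v, u) + x u - x v, 1 + z u - z v))"

text \<open>Potentials telescope, so a closed walk sums to its weight and its length. For a cycle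
  the length is positive, so this pair is positive exactly when the weight is nonnegative; this is
  how zero cycles come to count for Max.\<close>

lemma reduced_slack_sum:
  assumes "reduced_slack G w x z s" "pcas a p b" "set p \<subseteq> parcs G"
  shows "sum_list (map (\<lambda>e. s (fst e) (snd e)) p) =
    (sum_list (map w p) + x b - x a, real (length p) + z b - z a)"
  using assms(2,3)
proof (induction p arbitrary: a)
  case Nil
  then show ?case by (simp add: zero_prod_def)
next
  case (Cons e p)
  then have "e \<in> parcs G" by simp
  then have "s (fst e) (snd e) = (w e + x (snd e) - x (fst e), 1 + z (snd e) - z (fst e))"
    using assms(1) by (cases e) (auto simp: reduced_slack_def)
  moreover have "sum_list (map (\<lambda>e. s (fst e) (snd e)) p) =
      (sum_list (map w p) + x b - x (snd e), real (length p) + z b - z (snd e))"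
    using Cons by simp
  ultimately show ?case using Cons.prems(1) by simp
qed

lemma pawalk_verts_pcas: "pcas a p b \<Longrightarrow> pawalk_verts a p = a # map snd p"
  by (induction p arbitrary: a) auto

lemma pcas_append: "pcas a (p @ q) b \<longleftrightarrow> (\<exists>c. pcas a p c \<and> pcas c q b)"
  by (induction p arbitrary: a) auto

context arena
begin

abbreviation edge :: "'v \<Rightarrow> 'v \<Rightarrow> bool" where
  "edge v u \<equiv> (v, u) \<in> parcs G"

lemma slack_game: "slack_game (pverts G) VMax edge"
  by unfold_locales (use pair_finite_verts nodes_partition in \<open>auto dest: in_arcsD1 in_arcsD2\<close>)

sublocale sg: slack_game "pverts G" VMax edge
  by (rule slack_game)

text \<open>The potentials exist only in the proofs. Subtracting the two components of the gap from
  them on the region gives the shifted slacks, whatever the value of \<open>gap\<close> is.\<close>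

lemma reduced_slack_step:
  assumes "reduced_slack G w x z s"
  obtains x' z' where "reduced_slack G w x' z' (sg.step s)"
proof
  define \<delta> where "\<delta> = sg.gap s"
  show "reduced_slack G w (\<lambda>v. if v \<in> sg.attr s then x v - fst \<delta> else x v)
     (\<lambda>v. if v \<in> sg.attr s then z v - snd \<delta> else z v) (sg.step s)"
    using assms unfolding reduced_slack_def sg.step_def sg.shift_def \<delta>_def[symmetric]
    by (auto simp: prod_eq_iff)
qed

lemma reduced_slack_iterate:
  assumes "reduced_slack G w x z s"
  shows "\<exists>x z. reduced_slack G w x z ((sg.step ^^ k) s)"
proof (induction k)
  case 0
  show ?case using assms by auto
next
  case (Suc k)
  then obtain x z where "reduced_slack G w x z ((sg.step ^^ k) s)" by blast
  then show ?case by (rule reduced_slack_step) auto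
qed

text \<open>A vanishing second component says \<open>z v = z u + 1\<close>: the perturbation itself
  supplies the decreasing function that the duality asks for.\<close>

lemma reduced_slack_zero_edge:
  assumes "reduced_slack G w x z s" "edge v u" "s v u = 0"
  shows "z u < z v"
  using assms by (auto simp: reduced_slack_def zero_prod_def)

lemma active_eventually_empty:
  assumes "reduced_slack G w x z s"
  shows "\<exists>k < (card (pverts G) + 1) * (2 * (2 ^ (card (pverts G) div 2 + 1) *
     (card (pverts G) * card (pverts G) + 1))). sg.active ((sg.step ^^ k) s) = {}"
proof -
  obtain X Z where XZ: "\<And>k. reduced_slack G w (X k) (Z k) ((sg.step ^^ k) s)"
    using reduced_slack_iterate[OF assms] by metis
  show ?thesis
    by (rule sg.active_eventually_empty[of "\<lambda>k. (sg.step ^^ k) s" Z])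
       (use reduced_slack_zero_edge[OF XZ] in auto)
qed

lemma inactive_edge:
  assumes "sg.active s = {}" "edge a b"
  shows "a \<in> sg.attr s \<Longrightarrow> s a b < 0 \<Longrightarrow> b \<in> sg.attr s"
    and "a \<notin> sg.attr s \<Longrightarrow> 0 < s a b \<Longrightarrow> b \<notin> sg.attr s"
  using assms by (auto simp: sg.active_def)

text \<open>Outside the region Max picks an edge of nonnegative slack that stays outside. Without
  active edges such an edge exists, and all edges of Min from there behave in the same way, so every
  reachable cycle has a nonnegative slack sum.\<close>

lemma winning_outside_attr:
  assumes red: "reduced_slack G w x z s" and fin: "sg.active s = {}"
    and v: "v \<in> pverts G - sg.attr s"
  shows "winning_for_max G VMax VMin w v"
proof -
  have ex: "\<exists>u. edge a u \<and> (a \<notin> sg.attr s \<longrightarrow> 0 \<le> s a u \<and> u \<notin> sg.attr s)" if a: "a \<in> VMax" for a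
  proof (cases "a \<in> sg.attr s")
    \<comment> \<open>Nodes of the region will never be reached, so any outgoing edge serves as the
      choice there.\<close>
    case True
    then show ?thesis using out_edge[of a] a nodes_partition(1) by force
  next
    case False
    then obtain u where u: "edge a u" "\<not> (s a u < 0 \<or> s a u = 0 \<and> u \<in> sg.attr s)"
      using sg.attr_max[OF a, of s] by blast
    then have "u \<notin> sg.attr s" using inactive_edge(2)[OF fin u(1) False] by fastforce
    then show ?thesis using u by auto
  qed
  define f where "f a = (SOME u. edge a u \<and> (a \<notin> sg.attr s \<longrightarrow> 0 \<le> s a u \<and> u \<notin> sg.attr s))" for a
  have f: "edge a (f a)" "a \<notin> sg.attr s \<Longrightarrow> 0 \<le> s a (f a) \<and> f a \<notin> sg.attr s" if "a \<in> VMax" for a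
    using someI_ex[OF ex[OF that]] unfolding f_def[symmetric] by auto
  define H where "H = strategy_graph G VMax VMin (\<lambda>a. (a, f a))"
  have pos: "positional_strategy G VMax (\<lambda>a. (a, f a))"
    using f by (simp add: positional_strategy_def)
  have H_sub: "parcs H \<subseteq> parcs G" using f by (auto simp: H_def strategy_graph_def)
  have stay: "0 \<le> s a b \<and> b \<notin> sg.attr s" if "(a, b) \<in> parcs H" "a \<notin> sg.attr s" for a b
  proof (cases "a \<in> VMax")
    case True
    then have "b = f a" using that nodes_partition(2) by (auto simp: H_def strategy_graph_def)
    then show ?thesis using f[OF True] that by simp
  next
    case False
    then have a: "edge a b" "a \<in> pverts G - VMax"
      using that nodes_partition by (auto simp: H_def strategy_graph_def)
    then have nb: "\<not> (s a b < 0 \<or> s a b = 0 \<and> b \<in> sg.attr s)"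
      using sg.attr_min[of a s] that(2) by blast
    then have "b \<notin> sg.attr s" using inactive_edge(2)[OF fin a(1) that(2)] by fastforce
    then show ?thesis using nb by auto
  qed
  have walk: "b \<notin> sg.attr s \<and> (\<forall>e\<in>set p. 0 \<le> s (fst e) (snd e))"
    if "pcas a p b" "set p \<subseteq> parcs H" "a \<notin> sg.attr s" for a p b
    using that
  proof (induction p arbitrary: a)
    case (Cons e p)
    then have "0 \<le> s (fst e) (snd e) \<and> snd e \<notin> sg.attr s" using stay[of "fst e" "snd e"] by auto
    then show ?case using Cons by auto
  qed simp
  have reach: "b \<notin> sg.attr s" if "v \<rightarrow>\<^sup>*\<^bsub>H\<^esub> b" for b
    using that unfolding reachable_def with_proj_simps
    by (induction rule: rtrancl_on_induct) (use v stay in auto)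
  have "0 \<le> sum_list (map w p)"
    if cyc: "pre_digraph.cycle H p" and e: "e \<in> set p" "v \<rightarrow>\<^sup>*\<^bsub>H\<^esub> fst e" for p e
  proof -
    obtain a where a: "pcas a p a" "set p \<subseteq> parcs H"
      using cyc by (auto simp: pre_digraph.cycle_def pre_digraph.awalk_def cas_with_proj_eq)
    \<comment> \<open>Only the tail of \<open>e\<close> is known to be reachable. Following the
      cycle from there to its base point \<open>a\<close> shows that \<open>a\<close>, and then the
      whole cycle, lies outside the region.\<close>
    obtain p1 p2 where p: "p = p1 @ e # p2" using e(1) by (meson split_list)
    obtain c where c: "pcas a p1 c" "pcas c (e # p2) a"
      using a(1) by (auto simp: p pcas_append)
    then have "c \<notin> sg.attr s" using reach[OF e(2)] by simp
    then have "a \<notin> sg.attr s" "\<forall>e\<in>set p2. 0 \<le> s (fst e) (snd e)" "0 \<le> s (fst e) (snd e)"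
      using walk[OF c(2)] a(2) p by auto
    then have "\<forall>e\<in>set p. 0 \<le> s (fst e) (snd e)"
      using walk[OF a] by blast
    then have "0 \<le> sum_list (map (\<lambda>e. s (fst e) (snd e)) p)" by (intro sum_list_nonneg) auto
    then show ?thesis
      using reduced_slack_sum[OF red a(1)] a(2) H_sub by (auto simp: zero_prod_def)
  qed
  then show ?thesis
    unfolding winning_for_max_def using v pos by (intro conjI exI[of _ "\<lambda>a. (a, f a)"])
      (auto simp: H_def)
qed

text \<open>Whatever Max's strategy, each node of the region keeps an edge of nonpositive slack into
  the region: for Max every edge is one, for Min some edge is. Following these edges closes a cycle
  with slack sum at most zero; the second component of the sum is a positive length, so the weight
  is negative.\<close>

lemma not_winning_inside_attr:
  assumes red: "reduced_slack G w x z s" and fin: "sg.active s = {}" and v: "v \<in> sg.attr s"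
  shows "\<not> winning_for_max G VMax VMin w v"
proof
  assume "winning_for_max G VMax VMin w v"
  then obtain \<sigma> where \<sigma>: "positional_strategy G VMax \<sigma>"
    and nonneg: "\<And>p e. pre_digraph.cycle (strategy_graph G VMax VMin \<sigma>) p \<Longrightarrow> e \<in> set p \<Longrightarrow>
      v \<rightarrow>\<^sup>*\<^bsub>strategy_graph G VMax VMin \<sigma>\<^esub> fst e \<Longrightarrow> 0 \<le> sum_list (map w p)"
    unfolding winning_for_max_def by blast
  define H where "H = strategy_graph G VMax VMin \<sigma>"
  have "\<exists>b. (a, b) \<in> parcs H \<and> b \<in> sg.attr s \<and> s a b \<le> 0" if a: "a \<in> sg.attr s" for a
  proof (cases "a \<in> VMax")
    case True
    then have "\<sigma> a \<in> parcs G" "(a, snd (\<sigma> a)) = \<sigma> a"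
      using \<sigma> by (auto simp: positional_strategy_def prod_eq_iff)
    then have e: "edge a (snd (\<sigma> a))" "(a, snd (\<sigma> a)) \<in> parcs H"
      using True by (simp_all add: H_def strategy_graph_def)
    then have "s a (snd (\<sigma> a)) < 0 \<or> s a (snd (\<sigma> a)) = 0 \<and> snd (\<sigma> a) \<in> sg.attr s"
      using sg.attr_max[OF True, of s] a by blast
    then show ?thesis using e inactive_edge(1)[OF fin e(1) a] by auto
  next
    case False
    then have am: "a \<in> pverts G - VMax" using a sg.attr_subset by blast
    then obtain b where b: "edge a b" "s a b < 0 \<or> s a b = 0 \<and> b \<in> sg.attr s"
      using sg.attr_min[of a s] a by blast
    then have "(a, b) \<in> parcs H" using am nodes_partition by (auto simp: H_def strategy_graph_def)
    then show ?thesis using b inactive_edge(1)[OF fin b(1) a] by auto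
  qed
  then obtain f where f: "\<And>a. a \<in> sg.attr s \<Longrightarrow> (a, f a) \<in> parcs H \<and> f a \<in> sg.attr s \<and> s a (f a) \<le> 0"
    by metis
  have H: "parcs H \<subseteq> parcs G" "pverts H = pverts G"
    using \<sigma> by (auto simp: H_def strategy_graph_def positional_strategy_def)
  define g where "g k = (f ^^ k) v" for k
  have g_Suc: "g (Suc k) = f (g k)" for k by (simp add: g_def)
  have g_attr: "g k \<in> sg.attr s" for k
    by (induction k) (use v f in \<open>auto simp: g_def\<close>)
  have g_V: "g k \<in> pverts G" for k using g_attr sg.attr_subset by blast
  have "\<not> inj_on g UNIV"
    using finite_imageD[of g UNIV] finite_subset[OF _ sg.finite_attr[of s], of "range g"] g_attr by auto
  then have "\<exists>j i. i < j \<and> g i = g j" by (metis injI linorder_neqE_nat)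
  \<comment> \<open>The earliest repetition is chosen because \<open>cycle\<close> demands distinct
    nodes.\<close>
  then obtain j where j: "\<exists>i<j. g i = g j" "\<And>b a. b < j \<Longrightarrow> a < b \<Longrightarrow> g a \<noteq> g b"
    using exists_least_iff[of "\<lambda>j. \<exists>i<j. g i = g j"] by auto
  then obtain i where i: "i < j" "g i = g j" by blast
  define p where "p = map (\<lambda>k. (g k, g (Suc k))) [i..<j]"
  have "pcas (g i) (map (\<lambda>k. (g k, g (Suc k))) [i..<i + l]) (g (i + l))" for l
  proof (induction l)
    case (Suc l)
    have "pcas a (q @ [(b, c)]) c" if "pcas a q b" for a b c q
      unfolding pcas_append using that by (intro exI[of _ b]) simp
    from this[OF Suc] show ?case by simp
  qed simp
  from this[of "j - i"] have cas: "pcas (g i) p (g i)" using i by (simp add: p_def)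
  have p_sub: "set p \<subseteq> parcs H" using f[OF g_attr] g_Suc by (auto simp: p_def)
  have "inj_on g {Suc i..<Suc j}"
  proof (rule linorder_inj_onI')
    fix a b assume ab: "a \<in> {Suc i..<Suc j}" "b \<in> {Suc i..<Suc j}" "a < b"
    show "g a \<noteq> g b"
    proof (cases "b = j")
      case True
      then show ?thesis using j(2)[of a i] ab i by auto
    next
      case False
      then show ?thesis using j(2)[of b a] ab by auto
    qed
  qed
  moreover have "map snd p = map g [Suc i..<Suc j]"
    by (simp add: p_def map_Suc_upt[symmetric] del: upt_Suc)
  ultimately have "distinct (map snd p)" by (simp add: distinct_map del: upt_Suc)
  then have "distinct (tl (pawalk_verts (g i) p))" by (simp add: pawalk_verts_pcas[OF cas])
  moreover have p_ne: "p \<noteq> []" using i by (simp add: p_def)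
  ultimately have cyc: "pre_digraph.cycle H p"
    unfolding pre_digraph.cycle_def pre_digraph.awalk_def cas_with_proj_eq awalk_verts_with_proj_eq
      with_proj_simps H(2)
    using cas p_sub g_V by blast
  have reach: "v \<rightarrow>\<^sup>*\<^bsub>H\<^esub> g k" for k
    unfolding reachable_def with_proj_simps H(2)
  proof (induction k)
    case 0
    show ?case using g_V[of 0] by (simp add: g_def)
  next
    case (Suc k)
    then show ?case using f[OF g_attr[of k]] g_V[of "Suc k"] g_Suc
      by (auto intro: rtrancl_on_into_rtrancl_on)
  qed
  have "(g i, g (Suc i)) \<in> set p" unfolding p_def set_map using i(1) by (intro imageI) simp
  then have "0 \<le> sum_list (map w p)"
    using nonneg[of p "(g i, g (Suc i))"] cyc reach[of i] by (simp add: H_def)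
  moreover have "sum_list (map (\<lambda>e. s (fst e) (snd e)) p) \<le> 0"
    using f[OF g_attr] g_Suc by (intro sum_list_nonpos) (auto simp: p_def)
  moreover have "0 < length p" using p_ne by simp
  ultimately show False
    using reduced_slack_sum[OF red cas] p_sub H(1) by (auto simp: zero_prod_def)
qed

theorem winning_set_eq:
  assumes "reduced_slack G w x z s" "sg.active s = {}"
  shows "{v. winning_for_max G VMax VMin w v} = pverts G - sg.attr s"
proof -
  have "v \<in> pverts G" if "winning_for_max G VMax VMin w v" for v
    using that by (simp add: winning_for_max_def)
  then show ?thesis
    using winning_outside_attr[OF assms] not_winning_inside_attr[OF assms] by blast
qed

end

section \<open>Time and space of programs\<close>

definition nat_names :: "aname set" where
  "nat_names = {''n'', ''max'', ''adj'', ''win'', ''i'', ''j'', ''k'', ''r'', ''f'', ''go'', ''D''}"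

definition real_names :: "aname set" where
  "real_names = {''w'', ''u'', ''d'', ''e''}"

text \<open>Addresses up to \<open>n * n\<close> serve the matrices, values up to
  \<open>n * n\<close> the counter that runs through them. The extra 1 admits the flag value 1 in a
  game without nodes.\<close>

definition bounded_state :: "nat \<Rightarrow> state \<Rightarrow> bool" where
  "bounded_state n s \<longleftrightarrow>
     (\<forall>x i. nmem s x i \<noteq> 0 \<longrightarrow> x \<in> nat_names \<and> i \<le> n * n \<and> nmem s x i \<le> n * n + 1) \<and>
     (\<forall>x i. rmem s x i \<noteq> 0 \<longrightarrow> x \<in> real_names \<and> i \<le> n * n)"

text \<open>There are 11 arrays of naturals and 4 of reals, with \<open>n * n + 1\<close> addresses
  each. Binary lengths are estimated by the numbers themselves, which a polynomial bound can
  afford.\<close>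

definition space_bound :: "nat \<Rightarrow> nat" where
  "space_bound n = 11 * (n * n + 1) * (2 * (n * n + 1)) + 4 * (n * n + 1) * (n * n + 1)"

lemma floorlog_le: "floorlog 2 k \<le> k"
  by (rule floorlog_leI) auto

lemma space_bounded_state:
  assumes "bounded_state n s"
  shows "space s \<le> space_bound n"
proof -
  have fin: "finite nat_names" "finite real_names"
    and card: "card nat_names = 11" "card real_names = 4"
    by (simp_all add: nat_names_def real_names_def)
  have sum_le: "1 + a + b \<le> 2 * (m + 1)" if "a \<le> i" "b \<le> c" "i \<le> m" "c \<le> m + 1" for a b c i m :: nat
    using that by simp
  have "(\<Sum>(x, i)\<in>used_n s. 1 + floorlog 2 i + floorlog 2 (nmem s x i)) \<le>
      (\<Sum>(x, i)\<in>used_n s. 2 * (n * n + 1))"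
  proof (rule sum_mono, clarify)
    fix x i assume "(x, i) \<in> used_n s"
    then have "i \<le> n * n" "nmem s x i \<le> n * n + 1"
      using assms by (auto simp: bounded_state_def used_n_def)
    then show "1 + floorlog 2 i + floorlog 2 (nmem s x i) \<le> 2 * (n * n + 1)"
      using sum_le[OF floorlog_le floorlog_le] by blast
  qed
  also have "\<dots> \<le> (\<Sum>(x, i)\<in>nat_names \<times> {..n * n}. 2 * (n * n + 1))"
    using assms fin by (intro sum_mono2) (auto simp: bounded_state_def used_n_def)
  also have "\<dots> = 11 * (n * n + 1) * (2 * (n * n + 1))"
    by (simp add: split_def card card_cartesian_product)
  finally have n: "(\<Sum>(x, i)\<in>used_n s. 1 + floorlog 2 i + floorlog 2 (nmem s x i)) \<le>
      11 * (n * n + 1) * (2 * (n * n + 1))" .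
  have "(\<Sum>(x, i)\<in>used_r s. 1 + floorlog 2 i) \<le> (\<Sum>(x, i)\<in>used_r s. n * n + 1)"
  proof (rule sum_mono, clarify)
    fix x i assume "(x, i) \<in> used_r s"
    then have "i \<le> n * n" using assms by (auto simp: bounded_state_def used_r_def)
    then show "1 + floorlog 2 i \<le> n * n + 1" using floorlog_le[of i] by linarith
  qed
  also have "\<dots> \<le> (\<Sum>(x, i)\<in>real_names \<times> {..n * n}. n * n + 1)"
    using assms fin by (intro sum_mono2) (auto simp: bounded_state_def used_r_def)
  also have "\<dots> = 4 * (n * n + 1) * (n * n + 1)"
    by (simp add: split_def card card_cartesian_product)
  finally show ?thesis using n by (simp add: space_def space_bound_def)
qed

lemma nmem_nset: "nmem (nset x i k s) = (nmem s)(x := (nmem s x)(i := k))"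
  and rmem_nset: "rmem (nset x i k s) = rmem s"
  and nmem_rset: "nmem (rset x i r s) = nmem s"
  and rmem_rset: "rmem (rset x i r s) = (rmem s)(x := (rmem s x)(i := r))"
  by (simp_all add: nset_def rset_def)

lemmas mem_simps = nmem_nset rmem_nset nmem_rset rmem_rset

lemma bounded_state_nset:
  "bounded_state n s \<Longrightarrow> x \<in> nat_names \<Longrightarrow> i \<le> n * n \<Longrightarrow> k \<le> n * n + 1 \<Longrightarrow>
     bounded_state n (nset x i k s)"
  by (auto simp: bounded_state_def mem_simps)

lemma bounded_state_rset:
  "bounded_state n s \<Longrightarrow> x \<in> real_names \<Longrightarrow> i \<le> n * n \<Longrightarrow> bounded_state n (rset x i r s)"
  by (auto simp: bounded_state_def mem_simps)

text \<open>Total correctness with costs. The time bound varies with the program, the space bound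
  does not: every \<open>bounded_state\<close> meets it, so controlling space reduces to checking
  each write.\<close>

definition runs :: "nat \<Rightarrow> com \<Rightarrow> nat \<Rightarrow> (state \<Rightarrow> bool) \<Rightarrow> state \<Rightarrow> bool" where
  "runs n c T Q s \<longleftrightarrow> (\<exists>t m s'. exec c s t m s' \<and> t \<le> T \<and> m \<le> space_bound n \<and>
     bounded_state n s' \<and> Q s')"

lemma runs_mono:
  "runs n c T Q s \<Longrightarrow> T \<le> T' \<Longrightarrow> (\<And>s'. bounded_state n s' \<Longrightarrow> Q s' \<Longrightarrow> Q' s') \<Longrightarrow> runs n c T' Q' s"
  unfolding runs_def by (meson order_trans)

lemma runs_Seq:
  assumes "runs n c1 T1 (\<lambda>s'. bounded_state n s' \<longrightarrow> runs n c2 T2 Q s') s" "T1 + T2 \<le> T"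
  shows "runs n (Seq c1 c2) T Q s"
proof -
  obtain t1 m1 s1 t2 m2 s2 where "exec c1 s t1 m1 s1" "exec c2 s1 t2 m2 s2" "t1 \<le> T1" "t2 \<le> T2"
    "m1 \<le> space_bound n" "m2 \<le> space_bound n" "bounded_state n s2" "Q s2"
    using assms(1) unfolding runs_def by blast
  then show ?thesis
    unfolding runs_def using assms(2)
    by (intro exI[of _ "t1 + t2"] exI[of _ "max m1 m2"] exI[of _ s2]) (auto intro: exec.Seq)
qed

text \<open>The side conditions on writes preserve \<open>bounded_state\<close>. A loop gets
  \<open>False\<close>, being left to \<open>runs_While\<close>, so the value 0 that
  \<open>ctime\<close> assigns to loops is never relied on.\<close>

primrec wp :: "nat \<Rightarrow> com \<Rightarrow> (state \<Rightarrow> bool) \<Rightarrow> state \<Rightarrow> bool" where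
  "wp n Skip Q s = Q s"
| "wp n (NSet x i a) Q s = (x \<in> nat_names \<and> nval i s \<le> n * n \<and> nval a s \<le> n * n + 1 \<and>
     Q (nset x (nval i s) (nval a s) s))"
| "wp n (RSet x i a) Q s = (x \<in> real_names \<and> nval i s \<le> n * n \<and> Q (rset x (nval i s) (rval a s) s))"
| "wp n (Seq c1 c2) Q s = wp n c1 (wp n c2 Q) s"
| "wp n (Cond b c1 c2) Q s = (if bval b s then wp n c1 Q s else wp n c2 Q s)"
| "wp n (While b c) Q s = False"

primrec ctime :: "com \<Rightarrow> nat" where
  "ctime Skip = 1"
| "ctime (NSet x i a) = 1 + ntime i + ntime a"
| "ctime (RSet x i a) = 1 + ntime i + rtime a"
| "ctime (Seq c1 c2) = ctime c1 + ctime c2"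
| "ctime (Cond b c1 c2) = 1 + btime b + max (ctime c1) (ctime c2)"
| "ctime (While b c) = 0"

lemma runs_wp: "bounded_state n s \<Longrightarrow> wp n c Q s \<Longrightarrow> runs n c (ctime c) Q s"
proof (induction c arbitrary: s Q)
  case Skip
  then show ?case using space_bounded_state[of n s] exec.Skip[of s] unfolding runs_def
    by (intro exI[of _ 1] exI[of _ "space s"] exI[of _ s]) simp
next
  case (NSet x i a)
  let ?s' = "nset x (nval i s) (nval a s) s"
  have b: "bounded_state n ?s'" using NSet bounded_state_nset by simp
  then have "max (space s) (space ?s') \<le> space_bound n"
    using NSet.prems(1) space_bounded_state by simp
  then show ?case using exec.NSet[of ?s' x i s a] NSet.prems(2) b
    unfolding runs_def ctime.simps wp.simps by blast
next
  case (RSet x i a)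
  let ?s' = "rset x (nval i s) (rval a s) s"
  have b: "bounded_state n ?s'" using RSet bounded_state_rset by simp
  then have "max (space s) (space ?s') \<le> space_bound n"
    using RSet.prems(1) space_bounded_state by simp
  then show ?case using exec.RSet[of ?s' x i s a] RSet.prems(2) b
    unfolding runs_def ctime.simps wp.simps by blast
next
  case (Seq c1 c2)
  then have "runs n c1 (ctime c1) (wp n c2 Q) s" by simp
  then have "runs n c1 (ctime c1) (\<lambda>s'. bounded_state n s' \<longrightarrow> runs n c2 (ctime c2) Q s') s"
    by (rule runs_mono) (auto intro: Seq.IH)
  then show ?case by (rule runs_Seq) simp
next
  case (Cond b c1 c2)
  show ?case
  proof (cases "bval b s")
    case True
    then have "runs n c1 (ctime c1) Q s" using Cond by simp
    then obtain t m s' where "exec c1 s t m s'" "t \<le> ctime c1" "m \<le> space_bound n"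
      "bounded_state n s'" "Q s'" unfolding runs_def by blast
    then show ?thesis using exec.CondTrue[OF True, of c1 t m s' c2] unfolding runs_def
      by (intro exI[of _ "1 + btime b + t"] exI[of _ m] exI[of _ s']) auto
  next
    case False
    then have "runs n c2 (ctime c2) Q s" using Cond by simp
    then obtain t m s' where "exec c2 s t m s'" "t \<le> ctime c2" "m \<le> space_bound n"
      "bounded_state n s'" "Q s'" unfolding runs_def by blast
    then show ?thesis using exec.CondFalse[OF False, of c2 t m s' c1] unfolding runs_def
      by (intro exI[of _ "1 + btime b + t"] exI[of _ m] exI[of _ s']) auto
  qed
qed simp

text \<open>Every loop of the program, the main one included, has a number of iterations that is
  fixed in the proof beforehand. Indexing the invariant by the iteration yields termination and time
  at once.\<close>

lemma runs_While:
  assumes "bounded_state n s" "I k s" "k \<le> N"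
    and cont: "\<And>k s. k < N \<Longrightarrow> bounded_state n s \<Longrightarrow> I k s \<Longrightarrow> bval b s"
    and body: "\<And>k s. k < N \<Longrightarrow> bounded_state n s \<Longrightarrow> I k s \<Longrightarrow> runs n c Tb (I (Suc k)) s"
    and stop: "\<And>s. bounded_state n s \<Longrightarrow> I N s \<Longrightarrow> \<not> bval b s"
  shows "runs n (While b c) ((N - k) * (1 + btime b + Tb) + 1 + btime b) (I N) s"
  using assms(1-3)
proof (induction "N - k" arbitrary: k s)
  case 0
  then have "k = N" by simp
  then show ?case
    using 0 exec.WhileFalse[OF stop, of s c] space_bounded_state[of n s] unfolding runs_def
    by (intro exI[of _ "1 + btime b"] exI[of _ "space s"] exI[of _ s]) auto
next
  case (Suc d)
  then have k: "k < N" by simp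
  obtain t m s' where s': "exec c s t m s'" "t \<le> Tb" "m \<le> space_bound n" "bounded_state n s'" "I (Suc k) s'"
    using body[OF k Suc.prems(1,2)] unfolding runs_def by blast
  have "runs n (While b c) ((N - Suc k) * (1 + btime b + Tb) + 1 + btime b) (I N) s'"
    using Suc.hyps(1)[of "Suc k" s'] Suc.hyps(2) s' k by simp
  then obtain t' m' s'' where s'': "exec (While b c) s' t' m' s''"
    "t' \<le> (N - Suc k) * (1 + btime b + Tb) + 1 + btime b" "m' \<le> space_bound n" "bounded_state n s''" "I N s''"
    unfolding runs_def by blast
  have "exec (While b c) s (1 + btime b + t + t') (max m m') s''"
    using exec.WhileTrue[OF cont[OF k Suc.prems(1,2)] s'(1) s''(1)] .
  moreover have "N - k = Suc (N - Suc k)" using k by simp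
  ultimately show ?case unfolding runs_def using s' s''
    by (intro exI[of _ "1 + btime b + t + t'"] exI[of _ "max m m'"] exI[of _ s'']) auto
qed

abbreviation cell :: "aname \<Rightarrow> nexp" where
  "cell x \<equiv> NGet x (NConst 0)"

definition for_loop :: "aname \<Rightarrow> nexp \<Rightarrow> com \<Rightarrow> com" where
  "for_loop x b c = Seq (NSet x (NConst 0) (NConst 0))
     (While (NLess (cell x) b) (Seq c (NSet x (NConst 0) (NAdd (cell x) (NConst 1)))))"

text \<open>The premise \<open>frame\<close> says that the invariant ignores the counter, which is
  tracked separately. The bound 5 is the cost of \<open>size_sq\<close>; guard and increment then
  cost at most 15 per iteration, and the additional iteration in \<open>N + 1\<close> pays for the
  initialisation and the last test.\<close>

lemma runs_for_loop:
  assumes "bounded_state n s" "I 0 s" "x \<in> nat_names" "N \<le> n * n" "ntime b \<le> 5"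
    and frame: "\<And>k v s. I k s \<Longrightarrow> I k (nset x 0 v s)"
    and bound: "\<And>k s. I k s \<Longrightarrow> nval b s = N"
    and body: "\<And>k s. k < N \<Longrightarrow> bounded_state n s \<Longrightarrow> I k s \<Longrightarrow> nmem s x 0 = k \<Longrightarrow>
      runs n c Tb (\<lambda>s'. I (Suc k) s' \<and> nmem s' x 0 = k) s"
  shows "runs n (for_loop x b c) ((N + 1) * (Tb + 20)) (I N) s"
proof -
  let ?inc = "NSet x (NConst 0) (NAdd (cell x) (NConst 1))"
  let ?b = "NLess (cell x) b"
  let ?J = "\<lambda>k s. I k s \<and> nmem s x 0 = k"
  have step: "runs n (Seq c ?inc) (Tb + 6) (?J (Suc k)) s"
    if "k < N" "bounded_state n s" "?J k s" for k s
  proof (rule runs_Seq)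
    have "runs n c Tb (\<lambda>s'. I (Suc k) s' \<and> nmem s' x 0 = k) s" using body that by blast
    then show "runs n c Tb (\<lambda>s'. bounded_state n s' \<longrightarrow> runs n ?inc 6 (?J (Suc k)) s') s"
    proof (rule runs_mono)
      fix s' assume s': "I (Suc k) s' \<and> nmem s' x 0 = k"
      show "bounded_state n s' \<longrightarrow> runs n ?inc 6 (?J (Suc k)) s'"
      proof
        assume "bounded_state n s'"
        then have "runs n ?inc (ctime ?inc) (?J (Suc k)) s'"
          by (rule runs_wp) (use s' frame assms(3,4) that(1) in \<open>auto simp: mem_simps\<close>)
        then show "runs n ?inc 6 (?J (Suc k)) s'" by (rule runs_mono) auto
      qed
    qed simp
  qed simp
  have loop: "runs n (While ?b (Seq c ?inc)) ((N - 0) * (1 + btime ?b + (Tb + 6)) + 1 + btime ?b) (?J N) s"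
    if "bounded_state n s" "?J 0 s" for s
    using that by (intro runs_While[where I = ?J]) (use step bound in auto)
  let ?T = "N * (1 + btime ?b + (Tb + 6)) + 1 + btime ?b"
  have "runs n (NSet x (NConst 0) (NConst 0)) 3 (?J 0) s"
    using runs_wp[of n s "NSet x (NConst 0) (NConst 0)" "?J 0"] assms(1,2,3) frame
    by (simp add: mem_simps numeral_3_eq_3)
  then have "runs n (NSet x (NConst 0) (NConst 0)) 3
      (\<lambda>s'. bounded_state n s' \<longrightarrow> runs n (While ?b (Seq c ?inc)) ?T (?J N) s') s"
    by (rule runs_mono) (use loop in auto)
  then have "runs n (for_loop x b c) (3 + ?T) (?J N) s"
    unfolding for_loop_def by (rule runs_Seq) simp
  moreover have "3 + ?T \<le> (N + 1) * (Tb + 20)"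
  proof -
    have b: "btime ?b \<le> 8" using assms(5) by simp
    have "3 + ?T = N * (1 + btime ?b + (Tb + 6)) + (4 + btime ?b)" by (simp del: btime.simps)
    also have "\<dots> \<le> N * (Tb + 20) + (Tb + 20)"
      using b by (intro add_mono[OF mult_le_mono2]) linarith+
    finally show ?thesis by simp
  qed
  ultimately show ?thesis by (rule runs_mono) auto
qed

section \<open>The program\<close>

definition bor :: "bexp \<Rightarrow> bexp \<Rightarrow> bexp" where
  "bor a b = BNot (BAnd (BNot a) (BNot b))"

definition lex_less :: "rexp \<Rightarrow> rexp \<Rightarrow> rexp \<Rightarrow> rexp \<Rightarrow> bexp" where
  "lex_less a a' b b' = bor (RLess a b) (BAnd (BNot (RLess b a)) (RLess a' b'))"

abbreviation is_pos :: "nexp \<Rightarrow> bexp" where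
  "is_pos a \<equiv> NLess (NConst 0) a"

text \<open>The arrays \<open>w\<close> and \<open>u\<close> hold the two components of the slacks:
  the input weights are overwritten, and no potential is stored.\<close>

definition neg_at :: "nexp \<Rightarrow> bexp" where
  "neg_at e = lex_less (RGet ''w'' e) (RGet ''u'' e) (RConst 0) (RConst 0)"

definition pos_at :: "nexp \<Rightarrow> bexp" where
  "pos_at e = lex_less (RConst 0) (RConst 0) (RGet ''w'' e) (RGet ''u'' e)"

lemma bval_bor [simp]: "bval (bor a b) s \<longleftrightarrow> bval a s \<or> bval b s"
  by (simp add: bor_def)

lemma bval_lex_less [simp]:
  "bval (lex_less a a' b b') s \<longleftrightarrow> (rval a s, rval a' s) < (rval b s, rval b' s)"
  by (auto simp: lex_less_def)

lemma bval_neg_at [simp]: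
  "bval (neg_at e) s \<longleftrightarrow> (rmem s ''w'' (nval e s), rmem s ''u'' (nval e s)) < 0"
  by (simp add: neg_at_def zero_prod_def del: less_prod_simp)

lemma bval_pos_at [simp]:
  "bval (pos_at e) s \<longleftrightarrow> 0 < (rmem s ''w'' (nval e s), rmem s ''u'' (nval e s))"
  by (simp add: pos_at_def zero_prod_def del: less_prod_simp)

lemmas btime_simps = neg_at_def pos_at_def lex_less_def bor_def

abbreviation size_sq :: nexp where
  "size_sq \<equiv> NMul (cell ''n'') (cell ''n'')"

definition init_com :: com where
  "init_com = for_loop ''k'' size_sq (RSet ''u'' (cell ''k'') (RConst 1))"

definition clear_com :: com where
  "clear_com = for_loop ''i'' (cell ''n'') (NSet ''D'' (cell ''i'') (NConst 0))"

abbreviation edge_index :: nexp where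
  "edge_index \<equiv> NAdd (NMul (cell ''i'') (cell ''n'')) (cell ''j'')"

definition test_body :: com where
  "test_body =
     Cond (is_pos (NGet ''adj'' edge_index))
      (Cond (bor (neg_at edge_index)
              (BAnd (BNot (pos_at edge_index)) (is_pos (NGet ''D'' (cell ''j'')))))
        (Cond (is_pos (NGet ''max'' (cell ''i''))) Skip (NSet ''f'' (NConst 0) (NConst 1)))
        (Cond (is_pos (NGet ''max'' (cell ''i''))) (NSet ''f'' (NConst 0) (NConst 0)) Skip))
      Skip"

text \<open>The flag starts at 1 for Max and at 0 for Min, the neutral values of a universal and an
  existential test over the outgoing edges.\<close>

definition mark_com :: com where
  "mark_com =
     Seq (NSet ''f'' (NConst 0) (NGet ''max'' (cell ''i'')))
    (Seq (for_loop ''j'' (cell ''n'') test_body)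
         (Cond (is_pos (cell ''f'')) (NSet ''D'' (cell ''i'') (NConst 1)) Skip))"

definition attr_com :: com where
  "attr_com = Seq clear_com
     (for_loop ''r'' (cell ''n'') (for_loop ''i'' (cell ''n'') mark_com))"

definition record_gap :: "rexp \<Rightarrow> rexp \<Rightarrow> com" where
  "record_gap a b = Seq (RSet ''d'' (NConst 0) a)
     (Seq (RSet ''e'' (NConst 0) b) (NSet ''go'' (NConst 0) (NConst 1)))"

text \<open>\<open>go\<close> records whether a candidate has been seen, which avoids an infinite
  initial minimum. After the scan it tells whether an active edge exists, and so it doubles as the
  guard of the main loop.\<close>

definition improve_gap :: "rexp \<Rightarrow> rexp \<Rightarrow> com" where
  "improve_gap a b = Cond (is_pos (cell ''go''))
     (Cond (lex_less a b (RGet ''d'' (NConst 0)) (RGet ''e'' (NConst 0))) (record_gap a b) Skip)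
     (record_gap a b)"

abbreviation tail_marked :: bexp where
  "tail_marked \<equiv> is_pos (NGet ''D'' (NDiv (cell ''k'') (cell ''n'')))"

abbreviation head_marked :: bexp where
  "head_marked \<equiv> is_pos (NGet ''D'' (NMod (cell ''k'') (cell ''n'')))"

definition gap_body :: com where
  "gap_body =
     Cond (is_pos (NGet ''adj'' (cell ''k'')))
      (Cond tail_marked
        (Cond head_marked Skip
          (Cond (neg_at (cell ''k''))
            (improve_gap (RSub (RConst 0) (RGet ''w'' (cell ''k''))) (RSub (RConst 0) (RGet ''u'' (cell ''k''))))
            Skip))
        (Cond head_marked
          (Cond (pos_at (cell ''k'')) (improve_gap (RGet ''w'' (cell ''k'')) (RGet ''u'' (cell ''k''))) Skip)
          Skip))
      Skip"

definition gap_com :: com where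
  "gap_com = Seq (NSet ''go'' (NConst 0) (NConst 0)) (for_loop ''k'' size_sq gap_body)"

definition add_gap :: "(rexp \<Rightarrow> rexp \<Rightarrow> rexp) \<Rightarrow> com" where
  "add_gap f = Seq (RSet ''w'' (cell ''k'') (f (RGet ''w'' (cell ''k'')) (RGet ''d'' (NConst 0))))
     (RSet ''u'' (cell ''k'') (f (RGet ''u'' (cell ''k'')) (RGet ''e'' (NConst 0))))"

text \<open>Entries of non-edges are shifted as well; every test of a slack is guarded by
  \<open>adj\<close>, so they have no influence.\<close>

definition shift_body :: com where
  "shift_body = Cond tail_marked (Cond head_marked Skip (add_gap RAdd))
     (Cond head_marked (add_gap RSub) Skip)"

text \<open>
  In the last round \<open>d\<close> and \<open>e\<close> are stale, and the slacks after it are meaningless; only the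
  marks \<open>D\<close> are read afterwards.
\<close>

definition shift_com :: com where
  "shift_com = for_loop ''k'' size_sq shift_body"

definition win_com :: com where
  "win_com = for_loop ''i'' (cell ''n'')
     (NSet ''win'' (cell ''i'') (NSub (NConst 1) (NGet ''D'' (cell ''i''))))"

definition step_com :: com where
  "step_com = Seq attr_com (Seq gap_com shift_com)"

definition solve_com :: com where
  "solve_com = Seq init_com (Seq (NSet ''go'' (NConst 0) (NConst 1))
     (Seq (While (is_pos (cell ''go'')) step_com) win_com))"

section \<open>Verification of the program\<close>

lemma square_ge: "(k :: nat) < n \<Longrightarrow> k \<le> n * n"
  by (metis le_square less_imp_le_nat order_trans)

lemma index_less: "(i :: nat) < n \<Longrightarrow> j < n \<Longrightarrow> i * n + j < n * n"
proof -
  assume "i < n" "j < n"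
  then have "i * n + j < Suc i * n" by simp
  also have "\<dots> \<le> n * n" using \<open>i < n\<close> by (intro mult_le_mono1) simp
  finally show ?thesis .
qed

lemma div_less_square: "(k :: nat) < n * n \<Longrightarrow> k div n < n"
  by (simp add: less_mult_imp_div_less)

lemma mod_less_square: "(k :: nat) < n * n \<Longrightarrow> k mod n < n"
  by (cases n) auto

locale numbered_arena = arena G VMax VMin for G :: "nat pair_pre_digraph" and VMax VMin +
  fixes n :: nat
  assumes verts: "pverts G = {..<n}"
begin

lemma edge_less: "edge v u \<Longrightarrow> v < n \<and> u < n"
  using in_arcsD1 in_arcsD2 verts by auto

definition base :: "state \<Rightarrow> bool" where
  "base s \<longleftrightarrow> nmem s ''n'' 0 = n \<and> (\<forall>i<n. nmem s ''max'' i = of_bool (i \<in> VMax)) \<and>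
     (\<forall>l<n * n. nmem s ''adj'' l = of_bool (edge (l div n) (l mod n)))"

definition slack :: "(nat \<Rightarrow> nat \<Rightarrow> real \<times> real) \<Rightarrow> state \<Rightarrow> bool" where
  "slack S s \<longleftrightarrow> (\<forall>l<n * n. edge (l div n) (l mod n) \<longrightarrow>
     (rmem s ''w'' l, rmem s ''u'' l) = S (l div n) (l mod n))"

definition marks :: "nat set \<Rightarrow> state \<Rightarrow> bool" where
  "marks A s \<longleftrightarrow> (\<forall>i<n. nmem s ''D'' i = of_bool (i \<in> A))"

lemma base_nset [simp]: "x \<notin> {''n'', ''max'', ''adj''} \<Longrightarrow> base (nset x i k s) = base s"
proof -
  assume "x \<notin> {''n'', ''max'', ''adj''}"
  then have "nmem (nset x i k s) y = nmem s y" if "y \<in> {''n'', ''max'', ''adj''}" for y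
    using that unfolding mem_simps by (metis fun_upd_other)
  then show ?thesis by (simp only: base_def insert_iff simp_thms)
qed

lemma base_rset [simp]: "base (rset x i r s) = base s"
  by (simp only: base_def mem_simps)

lemma slack_nset [simp]: "slack S (nset x i k s) = slack S s"
  by (simp only: slack_def mem_simps)

lemma slack_rset [simp]: "x \<notin> {''w'', ''u''} \<Longrightarrow> slack S (rset x i r s) = slack S s"
proof -
  assume "x \<notin> {''w'', ''u''}"
  then have "rmem (rset x i r s) y = rmem s y" if "y \<in> {''w'', ''u''}" for y
    using that unfolding mem_simps by (metis fun_upd_other)
  then show ?thesis by (simp only: slack_def insert_iff simp_thms)
qed

lemma marks_nset [simp]: "x \<noteq> ''D'' \<Longrightarrow> marks A (nset x i k s) = marks A s"
  unfolding marks_def mem_simps by (metis fun_upd_other)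

lemma marks_rset [simp]: "marks A (rset x i r s) = marks A s"
  by (simp only: marks_def mem_simps)

lemma base_n: "base s \<Longrightarrow> nmem s ''n'' 0 = n"
  by (simp add: base_def)

section \<open>Initial slacks and cleared marks\<close>

lemma runs_init:
  assumes "bounded_state n s" "base s"
    and w: "\<And>l. l < n * n \<Longrightarrow> edge (l div n) (l mod n) \<Longrightarrow> rmem s ''w'' l = w (l div n, l mod n)"
  shows "runs n init_com ((n * n + 1) * 120) (\<lambda>s'. base s' \<and> slack (\<lambda>v u. (w (v, u), 1)) s') s"
proof -
  let ?I = "\<lambda>k s'. base s' \<and> (\<forall>l<n * n. edge (l div n) (l mod n) \<longrightarrow>
    rmem s' ''w'' l = w (l div n, l mod n)) \<and> (\<forall>l<k. rmem s' ''u'' l = 1)"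
  have "runs n init_com ((n * n + 1) * (100 + 20)) (?I (n * n)) s"
    unfolding init_com_def
  proof (rule runs_for_loop[where I = ?I])
    fix k s' assume h: "k < n * n" "bounded_state n s'" "?I k s'" "nmem s' ''k'' 0 = k"
    let ?c = "RSet ''u'' (cell ''k'') (RConst 1)"
    have "wp n ?c (\<lambda>s'. ?I (Suc k) s' \<and> nmem s' ''k'' 0 = k) s'"
      using h by (auto simp: real_names_def mem_simps less_Suc_eq)
    from runs_wp[OF h(2) this] show "runs n ?c 100 (\<lambda>s'. ?I (Suc k) s' \<and> nmem s' ''k'' 0 = k) s'"
      by (rule runs_mono) auto
  qed (use assms w in \<open>auto simp: nat_names_def mem_simps base_n\<close>)
  then show ?thesis by (rule runs_mono) (auto simp: slack_def)
qed

lemma runs_clear: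
  assumes "bounded_state n s" "base s" "slack S s"
  shows "runs n clear_com ((n + 1) * 120) (\<lambda>s'. base s' \<and> slack S s' \<and> marks {} s') s"
proof -
  let ?I = "\<lambda>k s'. base s' \<and> slack S s' \<and> (\<forall>l<k. nmem s' ''D'' l = 0)"
  have "runs n clear_com ((n + 1) * (100 + 20)) (?I n) s"
    unfolding clear_com_def
  proof (rule runs_for_loop[where I = ?I])
    fix k s' assume h: "k < n" "bounded_state n s'" "?I k s'" "nmem s' ''i'' 0 = k"
    let ?c = "NSet ''D'' (cell ''i'') (NConst 0)"
    have "wp n ?c (\<lambda>s'. ?I (Suc k) s' \<and> nmem s' ''i'' 0 = k) s'"
      using h square_ge[OF h(1)] by (auto simp: nat_names_def mem_simps less_Suc_eq)
    from runs_wp[OF h(2) this] show "runs n ?c 100 (\<lambda>s'. ?I (Suc k) s' \<and> nmem s' ''i'' 0 = k) s'"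
      by (rule runs_mono) auto
  qed (use assms in \<open>auto simp: nat_names_def mem_simps base_n\<close>)
  then show ?thesis by (rule runs_mono) (auto simp: marks_def)
qed

text \<open>The meaning of the flag \<open>f\<close> once the first \<open>k\<close> possible heads
  have been examined.\<close>

definition forced :: "(nat \<Rightarrow> nat \<Rightarrow> real \<times> real) \<Rightarrow> nat set \<Rightarrow> nat \<Rightarrow> nat \<Rightarrow> bool" where
  "forced S A i k \<longleftrightarrow>
     (if i \<in> VMax then \<forall>u<k. edge i u \<longrightarrow> S i u < 0 \<or> S i u = 0 \<and> u \<in> A
      else \<exists>u<k. edge i u \<and> (S i u < 0 \<or> S i u = 0 \<and> u \<in> A))"

lemma forced_Suc:
  "forced S A i (Suc k) \<longleftrightarrow>
     (if i \<in> VMax then forced S A i k \<and> (edge i k \<longrightarrow> S i k < 0 \<or> S i k = 0 \<and> k \<in> A)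
      else forced S A i k \<or> edge i k \<and> (S i k < 0 \<or> S i k = 0 \<and> k \<in> A))"
  unfolding forced_def less_Suc_eq by (simp; blast)

text \<open>The counters \<open>i\<close> and \<open>r\<close> of the enclosing loops are carried
  along because \<open>runs_for_loop\<close> expects a body to leave its counter unchanged.\<close>

lemma runs_test:
  assumes "bounded_state n s" "base s" "slack S s" "marks A s" "i < n" "nmem s ''i'' 0 = i"
    "nmem s ''r'' 0 = r" "nmem s ''f'' 0 = of_bool (i \<in> VMax)"
  shows "runs n (for_loop ''j'' (cell ''n'') test_body) ((n + 1) * 220)
    (\<lambda>s'. base s' \<and> slack S s' \<and> marks A s' \<and> nmem s' ''i'' 0 = i \<and> nmem s' ''r'' 0 = r \<and>
      nmem s' ''f'' 0 = of_bool (forced S A i n)) s"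
proof -
  let ?I = "\<lambda>k s'. base s' \<and> slack S s' \<and> marks A s' \<and> nmem s' ''i'' 0 = i \<and>
    nmem s' ''r'' 0 = r \<and> nmem s' ''f'' 0 = of_bool (forced S A i k)"
  have "runs n (for_loop ''j'' (cell ''n'') test_body) ((n + 1) * (200 + 20)) (?I n) s"
  proof (rule runs_for_loop[where I = ?I])
    fix k s' assume h: "k < n" "bounded_state n s'" "?I k s'" "nmem s' ''j'' 0 = k"
    have idx: "i * n + k < n * n" "(i * n + k) div n = i" "(i * n + k) mod n = k"
      using index_less assms(5) h(1) by auto
    have mem: "nmem s' ''n'' 0 = n" "nmem s' ''adj'' (i * n + k) = of_bool (edge i k)"
      "nmem s' ''max'' i = of_bool (i \<in> VMax)" "nmem s' ''D'' k = of_bool (k \<in> A)"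
      "edge i k \<Longrightarrow> (rmem s' ''w'' (i * n + k), rmem s' ''u'' (i * n + k)) = S i k"
      using h idx assms(5) by (auto simp: base_def marks_def slack_def)
    let ?P = "S i k < 0 \<or> S i k = 0 \<and> k \<in> A"
    have cond: "bval (bor (neg_at edge_index)
        (BAnd (BNot (pos_at edge_index)) (is_pos (NGet ''D'' (cell ''j''))))) s' \<longleftrightarrow> ?P" if "edge i k"
      using mem(1,4) mem(5)[OF that] h(3,4) by (simp del: less_prod_simp) auto
    have "wp n test_body (\<lambda>s'. ?I (Suc k) s' \<and> nmem s' ''j'' 0 = k) s'"
    proof (cases "edge i k")
      case True
      then show ?thesis using h(3,4) mem(1-4) cond[OF True] unfolding test_body_def wp.simps
        by (cases ?P; cases "i \<in> VMax") (simp_all add: nat_names_def mem_simps forced_Suc)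
    next
      case False
      then show ?thesis using h(3,4) mem(1-4) unfolding test_body_def wp.simps
        by (simp add: forced_Suc)
    qed
    from runs_wp[OF h(2) this]
    show "runs n test_body 200 (\<lambda>s'. ?I (Suc k) s' \<and> nmem s' ''j'' 0 = k) s'"
      by (rule runs_mono) (auto simp: test_body_def btime_simps)
  qed (use assms in \<open>auto simp: nat_names_def mem_simps base_n forced_def square_ge\<close>)
  then show ?thesis by (rule runs_mono) auto
qed


section \<open>Computing the forced region by repeated sweeps\<close>

definition mark :: "(nat \<Rightarrow> nat \<Rightarrow> real \<times> real) \<Rightarrow> nat set \<Rightarrow> nat \<Rightarrow> nat set" where
  "mark S A i = (if i \<in> sg.force_max S A \<union> sg.force_min S A then insert i A else A)"

primrec sweep :: "(nat \<Rightarrow> nat \<Rightarrow> real \<times> real) \<Rightarrow> nat set \<Rightarrow> nat \<Rightarrow> nat set" where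
  "sweep S A 0 = A"
| "sweep S A (Suc k) = mark S (sweep S A k) k"

lemma forced_iff: "i < n \<Longrightarrow> forced S A i n \<longleftrightarrow> i \<in> sg.force_max S A \<union> sg.force_min S A"
proof -
  assume "i < n"
  then have "i \<in> pverts G" using verts by simp
  then show ?thesis
    using edge_less[of i] unfolding forced_def sg.force_max_def sg.force_min_def
    by (cases "i \<in> VMax"; simp; blast)
qed

lemma sweep_mono: "k \<le> l \<Longrightarrow> sweep S A k \<subseteq> sweep S A l"
  by (rule lift_Suc_mono_le[of "sweep S A"]) (auto simp: mark_def)

lemma sweep_subset_attr: "A \<subseteq> sg.attr S \<Longrightarrow> sweep S A k \<subseteq> sg.attr S"
proof (induction k)
  case (Suc k)
  then have "sg.force_max S (sweep S A k) \<union> sg.force_min S (sweep S A k) \<subseteq> sg.attr S"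
    using sg.force_max_mono[of "sweep S A k" "sg.attr S" S]
      sg.force_min_mono[of "sweep S A k" "sg.attr S" S] sg.attr_unfold[of S] by blast
  then show ?case using Suc by (auto simp: mark_def)
qed simp

text \<open>Marking happens in place, so when the sweep visits \<open>i\<close> the marked set has
  only grown since \<open>A\<close>, and forcing is monotone.\<close>

lemma force_subset_sweep: "sg.force_max S A \<union> sg.force_min S A \<subseteq> sweep S A n"
proof
  fix i assume i: "i \<in> sg.force_max S A \<union> sg.force_min S A"
  then have "i \<in> pverts G"
    using sg.Mx_subset by (auto simp: sg.force_max_def sg.force_min_def)
  then have "i < n" using verts by simp
  have "i \<in> sg.force_max S (sweep S A i) \<union> sg.force_min S (sweep S A i)"
    using i sg.force_max_mono[of A "sweep S A i" S] sg.force_min_mono[of A "sweep S A i" S]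
      sweep_mono[of 0 i S A] by auto
  then have "i \<in> sweep S A (Suc i)" by (simp add: mark_def)
  then show "i \<in> sweep S A n" using sweep_mono[of "Suc i" n S A] \<open>i < n\<close> by auto
qed

text \<open>A sweep that marks nothing new leaves a set closed under forcing. Hence \<open>k\<close>
  sweeps either have reached the whole region or have marked at least \<open>k\<close> nodes, and
  \<open>n\<close> marked nodes are all nodes.\<close>

lemma iterated_sweep: "((\<lambda>A. sweep S A n) ^^ n) {} = sg.attr S"
proof -
  let ?F = "\<lambda>k. ((\<lambda>A. sweep S A n) ^^ k) {}"
  have sub: "?F k \<subseteq> sg.attr S" for k
    by (induction k) (auto intro: sweep_subset_attr[THEN subsetD])
  have fin: "finite (?F k)" for k using finite_subset[OF sub sg.finite_attr] .
  have "sg.attr S \<subseteq> ?F k \<or> k \<le> card (?F k)" for k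
  proof (induction k)
    case (Suc k)
    have inc: "?F k \<subseteq> ?F (Suc k)" using sweep_mono[of 0 n S "?F k"] by simp
    show ?case
    proof (cases "?F (Suc k) = ?F k")
      case True
      then have "sg.attr S \<subseteq> ?F k"
        using force_subset_sweep[of S "?F k"] by (intro sg.attr_lowerbound) simp
      then show ?thesis using inc by blast
    next
      case False
      then have "card (?F k) < card (?F (Suc k))" using inc fin psubset_card_mono by blast
      then show ?thesis using Suc inc by auto
    qed
  qed simp
  then have "sg.attr S \<subseteq> ?F n \<or> n \<le> card (?F n)" by blast
  moreover have "sg.attr S \<subseteq> ?F n" if "n \<le> card (?F n)"
  proof -
    have V: "?F n \<subseteq> {..<n}" using sub[of n] sg.attr_subset[of S] verts by simp
    then have "card (?F n) \<le> n" using card_mono[of "{..<n}"] by fastforce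
    then have "?F n = {..<n}" using card_subset_eq[OF _ V] that by simp
    then show ?thesis using sg.attr_subset[of S] verts by simp
  qed
  ultimately show ?thesis using sub by blast
qed

lemma runs_mark:
  assumes "bounded_state n s" "base s" "slack S s" "marks A s" "i < n" "nmem s ''i'' 0 = i"
    "nmem s ''r'' 0 = r"
  shows "runs n mark_com ((n + 1) * 220 + 30)
    (\<lambda>s'. base s' \<and> slack S s' \<and> marks (mark S A i) s' \<and> nmem s' ''i'' 0 = i \<and> nmem s' ''r'' 0 = r) s"
    (is "runs n _ _ ?Q s")
proof -
  let ?f = "NSet ''f'' (NConst 0) (NGet ''max'' (cell ''i''))"
  let ?t = "for_loop ''j'' (cell ''n'') test_body"
  let ?d = "Cond (is_pos (cell ''f'')) (NSet ''D'' (cell ''i'') (NConst 1)) Skip"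
  let ?P = "\<lambda>s'. base s' \<and> slack S s' \<and> marks A s' \<and> nmem s' ''i'' 0 = i \<and> nmem s' ''r'' 0 = r"
  have mark: "mark S A i = (if forced S A i n then insert i A else A)"
    by (simp only: mark_def forced_iff[OF assms(5)])
  have last: "runs n ?d 10 ?Q s'"
    if "bounded_state n s'" "?P s'" "nmem s' ''f'' 0 = of_bool (forced S A i n)" for s'
  proof -
    have "marks (insert i A) (nset ''D'' i (Suc 0) s')" if "marks A s'"
      using that assms(5) unfolding marks_def mem_simps by simp
    then have "wp n ?d ?Q s'"
      using that square_ge[OF assms(5)] mark
      by (cases "forced S A i n") (simp_all add: nat_names_def mem_simps)
    from runs_wp[OF that(1) this] show ?thesis by (rule runs_mono) simp_all
  qed
  have mid: "runs n (Seq ?t ?d) ((n + 1) * 220 + 10) ?Q s'"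
    if "bounded_state n s'" "?P s'" "nmem s' ''f'' 0 = of_bool (i \<in> VMax)" for s'
  proof (rule runs_Seq)
    have "runs n ?t ((n + 1) * 220) (\<lambda>s'. base s' \<and> slack S s' \<and> marks A s' \<and> nmem s' ''i'' 0 = i \<and>
        nmem s' ''r'' 0 = r \<and> nmem s' ''f'' 0 = of_bool (forced S A i n)) s'"
      by (rule runs_test) (use that assms(5) in auto)
    then show "runs n ?t ((n + 1) * 220) (\<lambda>s'. bounded_state n s' \<longrightarrow> runs n ?d 10 ?Q s') s'"
      by (rule runs_mono) (use last in auto)
  qed simp
  have "nmem s ''max'' i = of_bool (i \<in> VMax)" using assms(2,5) by (simp add: base_def)
  then have "wp n ?f (\<lambda>s'. ?P s' \<and> nmem s' ''f'' 0 = of_bool (i \<in> VMax)) s"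
    using assms by (simp add: nat_names_def mem_simps)
  from runs_wp[OF assms(1) this]
  have "runs n ?f 20 (\<lambda>s'. bounded_state n s' \<longrightarrow> runs n (Seq ?t ?d) ((n + 1) * 220 + 10) ?Q s') s"
    by (rule runs_mono) (use mid in auto)
  then show ?thesis unfolding mark_com_def by (rule runs_Seq) simp
qed

lemma runs_sweep:
  assumes "bounded_state n s" "base s" "slack S s" "marks A s" "nmem s ''r'' 0 = r"
  shows "runs n (for_loop ''i'' (cell ''n'') mark_com) ((n + 1) * ((n + 1) * 220 + 50))
    (\<lambda>s'. base s' \<and> slack S s' \<and> marks (sweep S A n) s' \<and> nmem s' ''r'' 0 = r) s"
proof -
  let ?I = "\<lambda>k s'. base s' \<and> slack S s' \<and> marks (sweep S A k) s' \<and> nmem s' ''r'' 0 = r"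
  have "runs n (for_loop ''i'' (cell ''n'') mark_com) ((n + 1) * (((n + 1) * 220 + 30) + 20)) (?I n) s"
  proof (rule runs_for_loop[where I = ?I])
    fix k s' assume h: "k < n" "bounded_state n s'" "?I k s'" "nmem s' ''i'' 0 = k"
    have "runs n mark_com ((n + 1) * 220 + 30) (\<lambda>s'. base s' \<and> slack S s' \<and>
        marks (mark S (sweep S A k) k) s' \<and> nmem s' ''i'' 0 = k \<and> nmem s' ''r'' 0 = r) s'"
      by (rule runs_mark) (use h in auto)
    then show "runs n mark_com ((n + 1) * 220 + 30) (\<lambda>s'. ?I (Suc k) s' \<and> nmem s' ''i'' 0 = k) s'"
      by (rule runs_mono) auto
  qed (use assms in \<open>auto simp: nat_names_def mem_simps base_n\<close>)
  then show ?thesis by (simp add: algebra_simps)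
qed

definition attr_time :: nat where
  "attr_time = (n + 1) * 120 + (n + 1) * ((n + 1) * ((n + 1) * 220 + 50) + 20)"

lemma runs_attr:
  assumes "bounded_state n s" "base s" "slack S s"
  shows "runs n attr_com attr_time (\<lambda>s'. base s' \<and> slack S s' \<and> marks (sg.attr S) s') s"
    (is "runs n _ _ ?Q s")
proof -
  let ?sw = "for_loop ''i'' (cell ''n'') mark_com"
  let ?F = "\<lambda>k. ((\<lambda>A. sweep S A n) ^^ k) {}"
  let ?I = "\<lambda>k s'. base s' \<and> slack S s' \<and> marks (?F k) s'"
  let ?T = "(n + 1) * ((n + 1) * ((n + 1) * 220 + 50) + 20)"
  have loop: "runs n (for_loop ''r'' (cell ''n'') ?sw) ?T ?Q s'"
    if "bounded_state n s'" "?I 0 s'" for s'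
  proof -
    have "runs n (for_loop ''r'' (cell ''n'') ?sw) ?T (?I n) s'"
    proof (rule runs_for_loop[where I = ?I])
      fix k s' assume h: "k < n" "bounded_state n s'" "?I k s'" "nmem s' ''r'' 0 = k"
      have "runs n ?sw ((n + 1) * ((n + 1) * 220 + 50)) (\<lambda>s'. base s' \<and> slack S s' \<and>
          marks (sweep S (?F k) n) s' \<and> nmem s' ''r'' 0 = k) s'"
        by (rule runs_sweep) (use h in auto)
      then show "runs n ?sw ((n + 1) * ((n + 1) * 220 + 50)) (\<lambda>s'. ?I (Suc k) s' \<and> nmem s' ''r'' 0 = k) s'"
        by (rule runs_mono) auto
    qed (use that in \<open>auto simp: nat_names_def mem_simps base_n\<close>)
    then show ?thesis unfolding iterated_sweep .
  qed
  have "runs n clear_com ((n + 1) * 120) (\<lambda>s'. base s' \<and> slack S s' \<and> marks {} s') s"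
    using assms by (rule runs_clear)
  then have "runs n clear_com ((n + 1) * 120)
      (\<lambda>s'. bounded_state n s' \<longrightarrow> runs n (for_loop ''r'' (cell ''n'') ?sw) ?T ?Q s') s"
    by (rule runs_mono) (use loop in auto)
  then show ?thesis unfolding attr_com_def by (rule runs_Seq) (simp add: attr_time_def)
qed

section \<open>The least room over the active edges\<close>

definition active_index :: "(nat \<Rightarrow> nat \<Rightarrow> real \<times> real) \<Rightarrow> nat \<Rightarrow> nat set" where
  "active_index S k = {l. l < k \<and> (l div n, l mod n) \<in> sg.active S}"

definition rooms :: "(nat \<Rightarrow> nat \<Rightarrow> real \<times> real) \<Rightarrow> nat \<Rightarrow> (real \<times> real) set" where
  "rooms S k = (\<lambda>l. sg.room S (l div n) (l mod n)) ` active_index S k"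

lemma finite_rooms: "finite (rooms S k)"
  unfolding rooms_def active_index_def by (intro finite_imageI) (simp add: finite_Collect_less_nat)

lemma rooms_0: "rooms S 0 = {}"
  by (simp add: rooms_def active_index_def)

lemma rooms_Suc:
  "rooms S (Suc k) = (if (k div n, k mod n) \<in> sg.active S
     then insert (sg.room S (k div n) (k mod n)) (rooms S k) else rooms S k)"
proof -
  have "active_index S (Suc k) = (if (k div n, k mod n) \<in> sg.active S
      then insert k (active_index S k) else active_index S k)"
    by (auto simp: active_index_def less_Suc_eq)
  then show ?thesis by (simp add: rooms_def)
qed

lemma rooms_all: "rooms S (n * n) = (\<lambda>(v, u). sg.room S v u) ` sg.active S"
proof -
  have "(\<lambda>l. (l div n, l mod n)) ` active_index S (n * n) = sg.active S"
  proof
    show "sg.active S \<subseteq> (\<lambda>l. (l div n, l mod n)) ` active_index S (n * n)"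
    proof (rule subrelI)
      fix v u assume vu: "(v, u) \<in> sg.active S"
      then have "v < n" "u < n" using edge_less by (auto simp: sg.active_def)
      then have "v * n + u < n * n" "(v * n + u) div n = v" "(v * n + u) mod n = u"
        using index_less by auto
      then show "(v, u) \<in> (\<lambda>l. (l div n, l mod n)) ` active_index S (n * n)"
        using vu by (intro image_eqI[of _ _ "v * n + u"]) (auto simp: active_index_def)
    qed
  qed (auto simp: active_index_def)
  from this[symmetric] show ?thesis by (simp add: rooms_def image_image)
qed

text \<open>\<open>R\<close> holds the candidates seen so far, \<open>c\<close> is the new one. The
  value of \<open>b\<close> must survive a write to \<open>d\<close>, since
  \<open>record_gap\<close> stores the first component before it evaluates the second.\<close>

lemma wp_improve_gap:
  assumes m: "R \<noteq> {} \<longrightarrow> (rmem s ''d'' 0, rmem s ''e'' 0) = Min R" and "finite R"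
    and go: "nmem s ''go'' 0 = of_bool (R \<noteq> {})"
    and ab: "(rval a s, rval b s) = c" "rval b (rset ''d'' 0 (rval a s) s) = rval b s"
    and Q: "\<And>s'. Q s' \<longleftrightarrow> P s' \<and> nmem s' ''go'' 0 = 1 \<and> (rmem s' ''d'' 0, rmem s' ''e'' 0) = Min (insert c R)"
    and P: "P s" "\<And>s x r. x \<in> {''d'', ''e''} \<Longrightarrow> P s \<Longrightarrow> P (rset x 0 r s)" "\<And>s v. P s \<Longrightarrow> P (nset ''go'' 0 v s)"
  shows "wp n (improve_gap a b) Q s"
proof -
  have rec: "wp n (record_gap a b) Q s" if "c = Min (insert c R)"
    using ab P that unfolding record_gap_def
    by (auto simp: Q real_names_def nat_names_def mem_simps)
  show ?thesis
  proof (cases "R = {}")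
    case True
    then show ?thesis using go rec by (simp add: improve_gap_def)
  next
    case False
    then have min: "Min (insert c R) = min c (Min R)" using \<open>finite R\<close> by simp
    have "wp n (improve_gap a b) Q s \<longleftrightarrow> (if c < Min R then wp n (record_gap a b) Q s else Q s)"
      using go m False ab(1) by (simp add: improve_gap_def del: less_prod_simp)
    moreover have "Q s" if "\<not> c < Min R"
      using that m go False P(1) min by (auto simp: Q min_def)
    moreover have "wp n (record_gap a b) Q s" if "c < Min R"
    proof (rule rec)
      show "c = Min (insert c R)" unfolding min using that by (simp add: min_absorb1 less_imp_le)
    qed
    ultimately show ?thesis by simp
  qed
qed

lemma runs_gap:
  assumes "bounded_state n s" "base s" "slack S s" "marks (sg.attr S) s"
  shows "runs n gap_com ((n * n + 1) * 220 + 3)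
    (\<lambda>s'. base s' \<and> slack S s' \<and> marks (sg.attr S) s' \<and> nmem s' ''go'' 0 = of_bool (sg.active S \<noteq> {}) \<and>
      (sg.active S \<noteq> {} \<longrightarrow> (rmem s' ''d'' 0, rmem s' ''e'' 0) = sg.gap S)) s" (is "runs n _ _ ?Q s")
proof -
  let ?P = "\<lambda>s'. base s' \<and> slack S s' \<and> marks (sg.attr S) s'"
  let ?I = "\<lambda>k s'. ?P s' \<and> nmem s' ''go'' 0 = of_bool (rooms S k \<noteq> {}) \<and>
    (rooms S k \<noteq> {} \<longrightarrow> (rmem s' ''d'' 0, rmem s' ''e'' 0) = Min (rooms S k))"
  have loop: "runs n (for_loop ''k'' size_sq gap_body) ((n * n + 1) * (200 + 20)) (?I (n * n)) s"
    if "bounded_state n s" "?I 0 s" for s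
  proof (rule runs_for_loop[where I = ?I])
    fix k s' assume h: "k < n * n" "bounded_state n s'" "?I k s'" "nmem s' ''k'' 0 = k"
    let ?v = "k div n" and ?u = "k mod n"
    let ?C = "\<lambda>s'. ?I (Suc k) s' \<and> nmem s' ''k'' 0 = k"
    have less: "?v < n" "?u < n" using h(1) div_less_square mod_less_square by auto
    have mem: "nmem s' ''n'' 0 = n" "nmem s' ''adj'' k = of_bool (edge ?v ?u)"
      "nmem s' ''D'' ?v = of_bool (?v \<in> sg.attr S)" "nmem s' ''D'' ?u = of_bool (?u \<in> sg.attr S)"
      "edge ?v ?u \<Longrightarrow> (rmem s' ''w'' k, rmem s' ''u'' k) = S ?v ?u"
      using h less by (simp_all add: base_def marks_def slack_def)
    have same: "?C s'" if "(?v, ?u) \<notin> sg.active S" using h that by (simp add: rooms_Suc)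
    have improve: "wp n (improve_gap a b) ?C s'"
      if act: "(?v, ?u) \<in> sg.active S" and ab: "(rval a s', rval b s') = sg.room S ?v ?u"
        "rval b (rset ''d'' 0 (rval a s') s') = rval b s'" for a b
    proof (rule wp_improve_gap[where R = "rooms S k" and P = "\<lambda>s'. ?P s' \<and> nmem s' ''k'' 0 = k"])
      show "?C s' \<longleftrightarrow> (?P s' \<and> nmem s' ''k'' 0 = k) \<and> nmem s' ''go'' 0 = 1 \<and>
          (rmem s' ''d'' 0, rmem s' ''e'' 0) = Min (insert (sg.room S ?v ?u) (rooms S k))" for s'
        using act by (auto simp: rooms_Suc)
    qed (use h ab finite_rooms in \<open>auto simp: mem_simps\<close>)
    have "wp n gap_body ?C s'"
    proof (cases "edge ?v ?u")
      case False
      then have "(?v, ?u) \<notin> sg.active S" by (simp add: sg.active_def)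
      from same[OF this] False show ?thesis using mem(2) h(4) by (simp add: gap_body_def)
    next
      case True
      have w: "(rmem s' ''w'' k, rmem s' ''u'' k) = S ?v ?u" by (rule mem(5)[OF True])
      have neg: "bval (neg_at (cell ''k'')) s' \<longleftrightarrow> S ?v ?u < 0"
        and pos: "bval (pos_at (cell ''k'')) s' \<longleftrightarrow> 0 < S ?v ?u"
        using w h(4) by (simp_all del: less_prod_simp)
      consider "(?v, ?u) \<in> sg.active S" "?v \<in> sg.attr S" "?u \<notin> sg.attr S" "S ?v ?u < 0"
        | "(?v, ?u) \<in> sg.active S" "?v \<notin> sg.attr S" "?u \<in> sg.attr S" "0 < S ?v ?u"
        | "(?v, ?u) \<notin> sg.active S"
        by (auto simp: sg.active_def)
      then show ?thesis
      proof cases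
        case 1
        have "wp n (improve_gap (RSub (RConst 0) (RGet ''w'' (cell ''k'')))
            (RSub (RConst 0) (RGet ''u'' (cell ''k'')))) ?C s'"
          by (rule improve[OF 1(1)]) (use w h(4) 1(2) in \<open>auto simp: sg.room_def mem_simps simp flip: w\<close>)
        then show ?thesis using 1 True mem(1-4) h(4) neg by (simp add: gap_body_def)
      next
        case 2
        have "wp n (improve_gap (RGet ''w'' (cell ''k'')) (RGet ''u'' (cell ''k''))) ?C s'"
          by (rule improve[OF 2(1)]) (use w h(4) 2(2) in \<open>auto simp: sg.room_def mem_simps\<close>)
        then show ?thesis using 2 True mem(1-4) h(4) pos by (simp add: gap_body_def)
      next
        case 3
        then have "\<not> (?v \<in> sg.attr S \<and> ?u \<notin> sg.attr S \<and> S ?v ?u < 0)"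
          "\<not> (?v \<notin> sg.attr S \<and> ?u \<in> sg.attr S \<and> 0 < S ?v ?u)"
          using True by (auto simp: sg.active_def)
        then show ?thesis using same[OF 3] True mem(1-4) h(4) neg pos
          by (cases "?v \<in> sg.attr S"; cases "?u \<in> sg.attr S") (simp_all add: gap_body_def)
      qed
    qed
    from runs_wp[OF h(2) this] show "runs n gap_body 200 ?C s'"
      by (rule runs_mono) (auto simp: gap_body_def btime_simps improve_gap_def record_gap_def)
  qed (use that in \<open>auto simp: nat_names_def mem_simps base_n\<close>)
  have fin: "?Q s" if "?I (n * n) s" for s
    using that unfolding rooms_all sg.gap_def by auto
  let ?g = "NSet ''go'' (NConst 0) (NConst 0)"
  have "wp n ?g (?I 0) s" using assms by (simp add: nat_names_def mem_simps rooms_0)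
  from runs_wp[OF assms(1) this]
  have "runs n ?g 3 (\<lambda>s'. bounded_state n s' \<longrightarrow> runs n (for_loop ''k'' size_sq gap_body)
      ((n * n + 1) * (200 + 20)) (?I (n * n)) s') s"
    by (rule runs_mono) (use loop in auto)
  then have "runs n gap_com ((n * n + 1) * 220 + 3) (?I (n * n)) s"
    unfolding gap_com_def by (rule runs_Seq) simp
  then show ?thesis by (rule runs_mono) (use fin in auto)
qed

section \<open>Shifting the slacks\<close>

lemma runs_shift:
  assumes "bounded_state n s" "base s" "slack S s" "marks (sg.attr S) s"
    and \<delta>: "(rmem s ''d'' 0, rmem s ''e'' 0) = \<delta>" and go: "nmem s ''go'' 0 = go"
  shows "runs n shift_com ((n * n + 1) * 120)
    (\<lambda>s'. base s' \<and> slack (sg.shift S \<delta>) s' \<and> marks (sg.attr S) s' \<and> nmem s' ''go'' 0 = go) s"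
proof -
  \<comment> \<open>Entries are rewritten in place. A new entry depends only on its old value, the
    marks and the stored gap, so all entries from \<open>k\<close> on still hold the old
    slacks.\<close>
  let ?val = "\<lambda>k l. if l < k then sg.shift S \<delta> (l div n) (l mod n) else S (l div n) (l mod n)"
  let ?I = "\<lambda>k s'. base s' \<and> marks (sg.attr S) s' \<and> nmem s' ''go'' 0 = go \<and>
    rmem s' ''d'' 0 = fst \<delta> \<and> rmem s' ''e'' 0 = snd \<delta> \<and>
    (\<forall>l. l < n * n \<longrightarrow> edge (l div n) (l mod n) \<longrightarrow> (rmem s' ''w'' l, rmem s' ''u'' l) = ?val k l)"
  have "runs n shift_com ((n * n + 1) * (100 + 20)) (?I (n * n)) s"
    unfolding shift_com_def
  proof (rule runs_for_loop[where I = ?I])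
    fix k s' assume h: "k < n * n" "bounded_state n s'" "?I k s'" "nmem s' ''k'' 0 = k"
    let ?v = "k div n" and ?u = "k mod n"
    let ?C = "\<lambda>s'. ?I (Suc k) s' \<and> nmem s' ''k'' 0 = k"
    have less: "?v < n" "?u < n" using h(1) div_less_square mod_less_square by auto
    have mem: "nmem s' ''n'' 0 = n"
      "nmem s' ''D'' ?v = of_bool (?v \<in> sg.attr S)" "nmem s' ''D'' ?u = of_bool (?u \<in> sg.attr S)"
      using h less by (simp_all add: base_def marks_def)
    have val: "?val (Suc k) l = (if l = k then sg.shift S \<delta> ?v ?u else ?val k l)" for l by auto
    have keep: "?C s'" if "sg.shift S \<delta> ?v ?u = S ?v ?u"
      using h that unfolding val by auto
    have change: "wp n (add_gap f) ?C s'"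
      if sh: "sg.shift S \<delta> ?v ?u = (g (fst (S ?v ?u)) (fst \<delta>), g (snd (S ?v ?u)) (snd \<delta>))"
        and f: "\<And>a b s. rval (f a b) s = g (rval a s) (rval b s)" for f g
    proof -
      let ?s = "rset ''u'' k (g (rmem s' ''u'' k) (snd \<delta>)) (rset ''w'' k (g (rmem s' ''w'' k) (fst \<delta>)) s')"
      have "(rmem ?s ''w'' l, rmem ?s ''u'' l) = ?val (Suc k) l"
        if l: "l < n * n" "edge (l div n) (l mod n)" for l
      proof (cases "l = k")
        case True
        then have "(rmem s' ''w'' k, rmem s' ''u'' k) = S ?v ?u" using h(3) l by simp
        then show ?thesis using True sh by (simp add: mem_simps prod_eq_iff)
      next
        case False
        then show ?thesis using h(3) l unfolding val by (simp add: mem_simps)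
      qed
      then have "?C ?s" using h by (simp add: mem_simps)
      then show ?thesis using h f by (simp add: add_gap_def real_names_def mem_simps)
    qed
    have "wp n shift_body ?C s'"
    proof (cases "?v \<in> sg.attr S")
      case True
      show ?thesis
      proof (cases "?u \<in> sg.attr S")
        case False
        then have "wp n (add_gap RAdd) ?C s'" using True
          by (intro change[of "(+)" RAdd]) (auto simp: sg.shift_def prod_eq_iff)
        then show ?thesis using True False mem h(4) by (simp add: shift_body_def)
      next
        case T: True
        then show ?thesis using True keep mem h(4) by (simp add: shift_body_def sg.shift_def)
      qed
    next
      case False
      show ?thesis
      proof (cases "?u \<in> sg.attr S")
        case True
        then have "wp n (add_gap RSub) ?C s'" using False
          by (intro change[of "(-)" RSub]) (auto simp: sg.shift_def prod_eq_iff)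
        then show ?thesis using True False mem h(4) by (simp add: shift_body_def)
      next
        case F: False
        then show ?thesis using False keep mem h(4) by (simp add: shift_body_def sg.shift_def)
      qed
    qed
    from runs_wp[OF h(2) this] show "runs n shift_body 100 ?C s'"
      by (rule runs_mono) (auto simp: shift_body_def add_gap_def)
  qed (use assms in \<open>auto simp: nat_names_def mem_simps base_n slack_def prod_eq_iff\<close>)
  then show ?thesis by (rule runs_mono) (auto simp: slack_def)
qed

lemma runs_win:
  assumes "bounded_state n s" "base s" "marks A s"
  shows "runs n win_com ((n + 1) * 120) (\<lambda>s'. output_set n s' = {..<n} - A) s"
proof -
  let ?I = "\<lambda>k s'. base s' \<and> marks A s' \<and> (\<forall>l<k. nmem s' ''win'' l = of_bool (l \<notin> A))"
  have "runs n win_com ((n + 1) * (100 + 20)) (?I n) s"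
    unfolding win_com_def
  proof (rule runs_for_loop[where I = ?I])
    fix k s' assume h: "k < n" "bounded_state n s'" "?I k s'" "nmem s' ''i'' 0 = k"
    let ?c = "NSet ''win'' (cell ''i'') (NSub (NConst 1) (NGet ''D'' (cell ''i'')))"
    have "nmem s' ''D'' k = of_bool (k \<in> A)" using h by (simp add: marks_def)
    then have "wp n ?c (\<lambda>s'. ?I (Suc k) s' \<and> nmem s' ''i'' 0 = k) s'"
      using h square_ge[OF h(1)] by (auto simp: nat_names_def mem_simps less_Suc_eq)
    from runs_wp[OF h(2) this] show "runs n ?c 100 (\<lambda>s'. ?I (Suc k) s' \<and> nmem s' ''i'' 0 = k) s'"
      by (rule runs_mono) auto
  qed (use assms in \<open>auto simp: nat_names_def mem_simps base_n\<close>)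
  then show ?thesis by (rule runs_mono) (auto simp: output_set_def)
qed


section \<open>The main loop and its running time\<close>

definition step_time :: nat where
  "step_time = attr_time + ((n * n + 1) * 220 + 3 + (n * n + 1) * 120)"

lemma runs_step:
  assumes "bounded_state n s" "base s" "slack S s"
  shows "runs n step_com step_time (\<lambda>s'. base s' \<and> marks (sg.attr S) s' \<and>
    nmem s' ''go'' 0 = of_bool (sg.active S \<noteq> {}) \<and> (sg.active S \<noteq> {} \<longrightarrow> slack (sg.step S) s')) s"
    (is "runs n _ _ ?Q s")
proof -
  let ?G = "\<lambda>s'. base s' \<and> slack S s' \<and> marks (sg.attr S) s' \<and>
    nmem s' ''go'' 0 = of_bool (sg.active S \<noteq> {}) \<and>
    (sg.active S \<noteq> {} \<longrightarrow> (rmem s' ''d'' 0, rmem s' ''e'' 0) = sg.gap S)"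
  have shift: "runs n shift_com ((n * n + 1) * 120) ?Q s'" if "bounded_state n s'" "?G s'" for s'
  proof -
    \<comment> \<open>The amount is whatever \<open>d\<close> and \<open>e\<close> contain; it is
      known to equal the gap only if some edge is active.\<close>
    have "runs n shift_com ((n * n + 1) * 120)
      (\<lambda>s''. base s'' \<and> slack (sg.shift S (rmem s' ''d'' 0, rmem s' ''e'' 0)) s'' \<and>
        marks (sg.attr S) s'' \<and> nmem s'' ''go'' 0 = of_bool (sg.active S \<noteq> {})) s'"
      by (rule runs_shift) (use that in auto)
    then show ?thesis by (rule runs_mono) (use that in \<open>auto simp: sg.step_def\<close>)
  qed
  have gap: "runs n (Seq gap_com shift_com) ((n * n + 1) * 220 + 3 + (n * n + 1) * 120) ?Q s'"
    if "bounded_state n s'" "base s'" "slack S s'" "marks (sg.attr S) s'" for s'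
  proof (rule runs_Seq)
    show "runs n gap_com ((n * n + 1) * 220 + 3)
        (\<lambda>s'. bounded_state n s' \<longrightarrow> runs n shift_com ((n * n + 1) * 120) ?Q s') s'"
      by (rule runs_mono[OF runs_gap[OF that]]) (use shift in auto)
  qed simp
  show ?thesis unfolding step_com_def
  proof (rule runs_Seq)
    show "runs n attr_com attr_time (\<lambda>s'. bounded_state n s' \<longrightarrow>
        runs n (Seq gap_com shift_com) ((n * n + 1) * 220 + 3 + (n * n + 1) * 120) ?Q s') s"
      by (rule runs_mono[OF runs_attr[OF assms]]) (use gap in auto)
  qed (simp add: step_time_def)
qed

lemma bounded_input: "bounded_state n (input_state n G VMax w)"
proof -
  have "n \<le> n * n + 1" using le_square[of n] by linarith
  then show ?thesis
    unfolding bounded_state_def input_state_def nat_names_def real_names_def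
    by (auto simp: square_ge split: if_splits)
qed

lemma base_input: "base (input_state n G VMax w)"
  by (auto simp: base_def input_state_def)

lemma input_slack:
  "l < n * n \<Longrightarrow> edge (l div n) (l mod n) \<Longrightarrow>
     rmem (input_state n G VMax w) ''w'' l = w (l div n, l mod n)"
  by (simp add: input_state_def)

definition round_bound :: nat where
  "round_bound = (n + 1) * (2 * (2 ^ (n div 2 + 1) * (n * n + 1)))"

definition solve_time :: nat where
  "solve_time = (n * n + 1) * 120 + (3 + (round_bound * (5 + step_time) + 5 + (n + 1) * 120))"

theorem runs_solve:
  "runs n solve_com solve_time
     (\<lambda>s'. output_set n s' = {v. winning_for_max G VMax VMin w v}) (input_state n G VMax w)"
  (is "runs n _ _ ?Q _")
proof -
  define S where "S k = (sg.step ^^ k) (\<lambda>v u. (w (v, u), 1 :: real))" for k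
  have red0: "reduced_slack G w (\<lambda>_. 0) (\<lambda>_. 0) (\<lambda>v u. (w (v, u), 1 :: real))"
    by (auto simp: reduced_slack_def)
  obtain K' where "K' < round_bound" "sg.active (S K') = {}"
    using active_eventually_empty[OF red0] unfolding round_bound_def S_def verts by auto
  then obtain K where K: "sg.active (S K) = {}" "\<And>k. k < K \<Longrightarrow> sg.active (S k) \<noteq> {}"
    using exists_least_iff[of "\<lambda>k. sg.active (S k) = {}"] by blast
  then have "K \<le> K'" using \<open>sg.active (S K') = {}\<close> not_less by blast
  with \<open>K' < round_bound\<close> have K_less: "K < round_bound" by simp
  have result: "{v. winning_for_max G VMax VMin w v} = {..<n} - sg.attr (S K)"
  proof -
    obtain x z where "reduced_slack G w x z (S K)"
      using reduced_slack_iterate[OF red0, of K] unfolding S_def by blast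
    from winning_set_eq[OF this K(1)] show ?thesis by (simp add: verts)
  qed
  \<comment> \<open>The body runs \<open>Suc K\<close> times: the round that finds no active edge is
    executed too and clears \<open>go\<close>. Its marks are the region of \<open>S K\<close>, while
    the memory is tied to the slacks \<open>S k\<close> only for \<open>k\<close> up to
    \<open>K\<close>.\<close>
  let ?I = "\<lambda>k s. base s \<and> nmem s ''go'' 0 = of_bool (k \<le> K) \<and> (k \<le> K \<longrightarrow> slack (S k) s) \<and>
    (K < k \<longrightarrow> marks (sg.attr (S K)) s)"
  let ?b = "is_pos (cell ''go'')"
  have body: "runs n step_com step_time (?I (Suc k)) s"
    if "k < Suc K" "bounded_state n s" "?I k s" for k s
  proof -
    have "slack (S k) s" "base s" using that by auto
    from runs_step[OF that(2) this(2,1)] show ?thesis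
    proof (rule runs_mono)
      fix s' assume s': "base s' \<and> marks (sg.attr (S k)) s' \<and>
        nmem s' ''go'' 0 = of_bool (sg.active (S k) \<noteq> {}) \<and>
        (sg.active (S k) \<noteq> {} \<longrightarrow> slack (sg.step (S k)) s')"
      show "?I (Suc k) s'"
      proof (cases "k = K")
        case True
        then show ?thesis using s' K(1) by simp
      next
        case False
        then have "k < K" using that(1) by simp
        then show ?thesis using s' K(2)[of k] by (simp add: S_def)
      qed
    qed simp
  qed
  have loop: "runs n (While ?b step_com) (round_bound * (5 + step_time) + 5) (?I (Suc K)) s"
    if "bounded_state n s" "?I 0 s" for s
  proof -
    have "runs n (While ?b step_com) ((Suc K - 0) * (1 + btime ?b + step_time) + 1 + btime ?b) (?I (Suc K)) s"
      using that by (intro runs_While[where I = ?I]) (use body in auto)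
    moreover have "(Suc K - 0) * (1 + btime ?b + step_time) + 1 + btime ?b
        \<le> round_bound * (5 + step_time) + 5"
    proof -
      have "Suc K * (5 + step_time) \<le> round_bound * (5 + step_time)"
        using K_less by (intro mult_le_mono1) simp
      then show ?thesis by (simp add: algebra_simps)
    qed
    ultimately show ?thesis by (rule runs_mono) auto
  qed
  have tail2: "runs n (Seq (While ?b step_com) win_com)
      (round_bound * (5 + step_time) + 5 + (n + 1) * 120) ?Q s"
    if "bounded_state n s" "?I 0 s" for s
  proof (rule runs_Seq)
    show "runs n (While ?b step_com) (round_bound * (5 + step_time) + 5)
        (\<lambda>s'. bounded_state n s' \<longrightarrow> runs n win_com ((n + 1) * 120) ?Q s') s"
      by (rule runs_mono[OF loop[OF that]]) (use runs_win result in auto)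
  qed simp
  have tail1: "runs n (Seq (NSet ''go'' (NConst 0) (NConst 1)) (Seq (While ?b step_com) win_com))
      (3 + (round_bound * (5 + step_time) + 5 + (n + 1) * 120)) ?Q s"
    if "bounded_state n s" "base s" "slack (S 0) s" for s
  proof (rule runs_Seq)
    have "wp n (NSet ''go'' (NConst 0) (NConst 1)) (?I 0) s"
      using that by (simp add: nat_names_def mem_simps)
    from runs_wp[OF that(1) this]
    show "runs n (NSet ''go'' (NConst 0) (NConst 1)) 3 (\<lambda>s'. bounded_state n s' \<longrightarrow>
        runs n (Seq (While ?b step_com) win_com)
          (round_bound * (5 + step_time) + 5 + (n + 1) * 120) ?Q s') s"
      by (rule runs_mono) (use tail2 in auto)
  qed simp
  show ?thesis unfolding solve_com_def
  proof (rule runs_Seq)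
    have "runs n init_com ((n * n + 1) * 120) (\<lambda>s'. base s' \<and> slack (S 0) s') (input_state n G VMax w)"
      using runs_init[of "input_state n G VMax w" w] bounded_input base_input input_slack
      by (simp add: S_def)
    then show "runs n init_com ((n * n + 1) * 120) (\<lambda>s'. bounded_state n s' \<longrightarrow>
        runs n (Seq (NSet ''go'' (NConst 0) (NConst 1)) (Seq (While ?b step_com) win_com))
          (3 + (round_bound * (5 + step_time) + 5 + (n + 1) * 120)) ?Q s') (input_state n G VMax w)"
      by (rule runs_mono) (use tail1 in auto)
  qed (simp add: solve_time_def)
qed

text \<open>The exponent 6 splits evenly: a round takes cubic time, and the number of rounds is at
  most \<open>2 ^ (n div 2)\<close> times a cubic factor. The constant 20000 generously rounds up
  4024.\<close>

lemma solve_time_le: "real solve_time \<le> 20000 * (real n + 1) ^ 6 * 2 powr (real n / 2)"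
proof -
  define N where "N = n + 1"
  define M where "M = n * n + 1"
  have N: "1 \<le> N" "M \<le> N ^ 2" by (simp_all add: N_def M_def power2_eq_square)
  have N3: "N \<le> N ^ 3" "N ^ 2 \<le> N ^ 3" "1 \<le> N ^ 3"
    using N(1) by (simp_all add: self_le_power power_increasing)
  have "attr_time = 220 * N ^ 3 + 50 * N ^ 2 + 140 * N"
    unfolding attr_time_def N_def[symmetric]
    by (simp add: power3_eq_cube power2_eq_square algebra_simps)
  then have attr: "attr_time \<le> 410 * N ^ 3" using N3 by linarith
  have "step_time = attr_time + 340 * M + 3" by (simp add: step_time_def M_def)
  then have step: "5 + step_time \<le> 758 * N ^ 3" using attr N(2) N3 by linarith
  have "0 < round_bound" unfolding round_bound_def by (intro mult_pos_pos) auto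
  then have pos: "1 \<le> round_bound" by simp
  have "solve_time = round_bound * (5 + step_time) + (120 * M + 120 * N + 8)"
    unfolding solve_time_def N_def M_def by simp
  also have "\<dots> \<le> round_bound * (758 * N ^ 3) + 1 * (248 * N ^ 3)"
    using step N(2) N3 by (intro add_mono[OF mult_le_mono2]) linarith+
  also have "\<dots> \<le> round_bound * (758 * N ^ 3) + round_bound * (248 * N ^ 3)"
    using pos by (intro add_left_mono mult_le_mono1)
  also have "\<dots> = round_bound * (1006 * N ^ 3)" by simp
  also have "\<dots> \<le> (4 * 2 ^ (n div 2) * N ^ 3) * (1006 * N ^ 3)"
  proof (rule mult_le_mono1)
    have "round_bound = 4 * 2 ^ (n div 2) * (N * M)"
      by (simp add: round_bound_def N_def M_def algebra_simps)
    also have "\<dots> \<le> 4 * 2 ^ (n div 2) * (N * N ^ 2)"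
      using N(2) by (intro mult_le_mono2)
    finally show "round_bound \<le> 4 * 2 ^ (n div 2) * N ^ 3" by (simp add: power3_eq_cube power2_eq_square)
  qed
  also have "\<dots> = 4024 * N ^ 6 * 2 ^ (n div 2)"
    using power_add[of N 3 3] by simp
  finally have "real solve_time \<le> real (4024 * N ^ 6 * 2 ^ (n div 2))" by (rule of_nat_mono)
  also have "\<dots> = 4024 * (real n + 1) ^ 6 * 2 ^ (n div 2)" by (simp add: N_def add.commute)
  also have "\<dots> \<le> 20000 * (real n + 1) ^ 6 * 2 powr (real n / 2)"
  proof (intro mult_mono)
    have "real (2 * (n div 2)) \<le> real n" by (rule of_nat_mono) simp
    then have half: "real (n div 2) \<le> real n / 2" by simp
    have "(2 :: real) ^ (n div 2) = 2 powr real (n div 2)" by (simp add: powr_realpow)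
    also have "\<dots> \<le> 2 powr (real n / 2)" using half by (intro powr_mono) auto
    finally show "(2 :: real) ^ (n div 2) \<le> 2 powr (real n / 2)" .
  qed auto
  finally show ?thesis .
qed

end

theorem theorem3:
  shows "\<exists>(P :: com) (T :: nat \<Rightarrow> real) (S :: nat \<Rightarrow> real) (k :: nat) (l :: nat).
    T \<in> O(\<lambda>n. real n ^ k * 2 powr (real n / 2)) \<and>
    S \<in> O(\<lambda>n. real n ^ l) \<and>
    (\<forall>(n :: nat) (G :: nat pair_pre_digraph) (VMax :: nat set) (VMin :: nat set)
        (w :: nat \<times> nat \<Rightarrow> real).
      arena G VMax VMin \<and> pverts G = {..<n} \<longrightarrow>
      (\<exists>t m s. exec P (input_state n G VMax w) t m s \<and>
         real t \<le> T n \<and> real m \<le> S n \<and>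
         output_set n s = {v. winning_for_max G VMax VMin w v}))"
proof (rule exI[of _ solve_com], rule exI[of _ "\<lambda>n. 20000 * (real n + 1) ^ 6 * 2 powr (real n / 2)"],
    rule exI[of _ "\<lambda>n. real (space_bound n)"], rule exI[of _ 6], rule exI[of _ 4],
    intro conjI allI impI)
  show "(\<lambda>n. 20000 * (real n + 1) ^ 6 * 2 powr (real n / 2)) \<in> O(\<lambda>n. real n ^ 6 * 2 powr (real n / 2))"
  \<comment> \<open>From \<open>n = 1\<close> on, \<open>n + 1\<close> is at most
    \<open>2 * n\<close>, whence the factor \<open>2 ^ 6\<close>.\<close>
  proof (rule bigoI[of _ "20000 * 2 ^ 6"], rule eventually_sequentiallyI[of 1])
    fix n :: nat assume "1 \<le> n"
    then have "(real n + 1) ^ 6 \<le> (2 * real n) ^ 6" by (intro power_mono) auto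
    then show "norm (20000 * (real n + 1) ^ 6 * 2 powr (real n / 2))
        \<le> 20000 * 2 ^ 6 * norm (real n ^ 6 * 2 powr (real n / 2))"
      by (simp add: power_mult_distrib)
  qed
  show "(\<lambda>n. real (space_bound n)) \<in> O(\<lambda>n. real n ^ 4)"
  \<comment> \<open>The two parts of \<open>space_bound\<close> add up to 26 times a square that is
    at most \<open>4 * n ^ 4\<close> from \<open>n = 1\<close> on, so already 104 would do.\<close>
  proof (rule bigoI[of _ 1000], rule eventually_sequentiallyI[of 1])
    fix n :: nat assume "1 \<le> n"
    then have "n * n + 1 \<le> 2 * (n * n)" by simp
    have "space_bound n = 26 * ((n * n + 1) * (n * n + 1))"
      by (simp add: space_bound_def algebra_simps)
    also have "\<dots> \<le> 26 * ((2 * (n * n)) * (2 * (n * n)))"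
      using \<open>n * n + 1 \<le> 2 * (n * n)\<close> by (intro mult_le_mono2 mult_le_mono)
    also have "\<dots> \<le> 1000 * n ^ 4" by (simp add: power4_eq_xxxx)
    finally have "space_bound n \<le> 1000 * n ^ 4" .
    then have "real (space_bound n) \<le> real (1000 * n ^ 4)" by (rule of_nat_mono)
    then show "norm (real (space_bound n)) \<le> 1000 * norm (real n ^ 4)" by simp
  qed
  fix n :: nat and G VMax VMin and w :: "nat \<times> nat \<Rightarrow> real"
  assume h: "arena G VMax VMin \<and> pverts G = {..<n}"
  interpret numbered_arena G VMax VMin n
    using h by (simp add: numbered_arena_def numbered_arena_axioms_def)
  obtain t m s where r: "exec solve_com (input_state n G VMax w) t m s" "t \<le> solve_time"
    "m \<le> space_bound n" "output_set n s = {v. winning_for_max G VMax VMin w v}"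
    using runs_solve[of w] unfolding runs_def by blast
  have "real t \<le> 20000 * (real n + 1) ^ 6 * 2 powr (real n / 2)"
    using r(2) solve_time_le by linarith
  then show "\<exists>t m s. exec solve_com (input_state n G VMax w) t m s \<and>
      real t \<le> 20000 * (real n + 1) ^ 6 * 2 powr (real n / 2) \<and> real m \<le> real (space_bound n) \<and>
      output_set n s = {v. winning_for_max G VMax VMin w v}"
    using r by auto
qed

end
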